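(* Let $\mathbf{P}\colon\mathsf{C}^{\mathrm{op}}\to\mathsf{BA}$ be a Boolean doctrine with $\mathsf{C}$ small, and let $(\mathrm{id}_{\mathsf{C}},\mathfrak{i})\colon\mathbf{P}\hookrightarrow\mathbf{P}^{\forall\exists}$ be a quantifier completion of $\mathbf{P}$. Let $S,Y_1,\dots,Y_{\bar i},W_1,\dots,W_{\bar h},Z_1,\dots,Z_{\bar j},V_1,\dots,V_{\bar k}\in\mathsf{C}$, $\alpha_i\in\mathbf{P}(S\times Y_i)$ ($i=1,\dots,\bar i$), $\gamma_h\in\mathbf{P}(S\times W_h)$ ($h=1,\dots,\bar h$), $\beta_j\in\mathbf{P}(S\times Z_j)$ ($j=1,\dots,\bar j$), $\delta_k\in\mathbf{P}(S\times V_k)$ ($k=1,\dots,\bar k$). The following are equivalent: (1) in $\mathbf{P}^{\forall\exists}(S)$, \[\Big(\bigwedge_{i=1}^{\bar i}\forall_S^{Y_i}\mathfrak{i}_{S\times Y_i}(\alpha_i)\Big)\land\Big(\bigwedge_{h=1}^{\bar h}\exists_S^{W_h}\mathfrak{i}_{S\times W_h}(\gamma_h)\Big)\le\Big(\bigvee_{j=1}^{\bar j}\forall_S^{Z_j}\mathfrak{i}_{S\times Z_j}(\beta_j)\Big)\lor\Big(\bigvee_{k=1}^{\bar k}\exists_S^{V_k}\mathfrak{i}_{S\times V_k}(\delta_k)\Big);\] (2) there are $n,n'\in\mathbb{N}$, $l_1,\dots,l_n\in\{1,\dots,\bar i\}$, $l'_1,\dots,l'_{n'}\in\{1,\dots,\bar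 k\}$, morphisms $g_i\colon S\times\prod_{j=1}^{\bar j}Z_j\times\prod_{h=1}^{\bar h}W_h\to Y_{l_i}$ ($i=1,\dots,n$) and $g'_k\colon S\times\prod_{j=1}^{\bar j}Z_j\times\prod_{h=1}^{\bar h}W_h\to V_{l'_k}$ ($k=1,\dots,n'$) such that in $\mathbf{P}(S\times\prod_{j=1}^{\bar j}Z_j\times\prod_{h=1}^{\bar h}W_h)$ \[\bigwedge_{i=1}^n\mathbf{P}(\langle\mathrm{pr}_1,g_i\rangle)(\alpha_{l_i})\land\bigwedge_{h=1}^{\bar h}\mathbf{P}(\langle\mathrm{pr}_1,\mathrm{pr}_{h+\bar j+1}\rangle)(\gamma_h)\le\bigvee_{j=1}^{\bar j}\mathbf{P}(\langle\mathrm{pr}_1,\mathrm{pr}_{j+1}\rangle)(\beta_j)\lor\bigvee_{k=1}^{n'}\mathbf{P}(\langle\mathrm{pr}_1,g'_k\rangle)(\delta_{l'_k}).\]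
   Context: Categories have finite products; $\mathbf{t}$ is a terminal object, $\mathrm{pr}_i$ the $i$-th projection of a finite product, $\langle f_1,\dots,f_n\rangle$ the induced morphism into a product. $\mathsf{BA}$ is the category of Boolean algebras. A Boolean doctrine over $\mathsf{C}$ is a functor $\mathbf{P}\colon\mathsf{C}^{\mathrm{op}}\to\mathsf{BA}$. A Boolean doctrine morphism $\mathbf{P}\to\mathbf{R}$ (with $\mathbf{R}\colon\mathsf{D}^{\mathrm{op}}\to\mathsf{BA}$) is a pair $(M,\mathfrak{m})$ with $M\colon\mathsf{C}\to\mathsf{D}$ finite-product preserving and $\mathfrak{m}\colon\mathbf{P}\Rightarrow\mathbf{R}\circ M^{\mathrm{op}}$ natural. A first-order Boolean doctrine is a Boolean doctrine such that for all $X,Y$ the map $\mathbf{P}(\mathrm{pr}_1)\colon\mathbf{P}(X)\to\mathbf{P}(X\times Y)$ has a right adjoint $\forall^Y_X$ (as monotone maps), and for every $f\colon X'\to X$, $\mathbf{P}(f)\circ\forall^Y_X=\forall^Y_{X'}\circ\mathbf{P}(f\times\mathrm{id}_Y)$ (Beck–Chevalley). One writes $\exists^Y_X=\neg\forall^Y_X\neg$ (the left adjoint of $\mathbf{P}(\mathrm{pr}_1)$). A first-order Boolean doctrine morphism is a Boolean doctrine morphism $(M,\mathfrak{m})$ with $\mathfrak{m}_X\circ\forall^Y_X=\forall^{M(Y)}_{M(X)}\circ\mathfrak{m}_{X\times Y}$. A quantifier completion of a Boolean doctrine $\mathbf{P}$ is a Boolean doctrine morphism $(\mathrm{id}_{\mathsf{C}},\mathfrak{i})\colon\mathbf{P}\to\mathbf{P}^{\forall\exists}$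 with $\mathbf{P}^{\forall\exists}\colon\mathsf{C}^{\mathrm{op}}\to\mathsf{BA}$ a first-order Boolean doctrine, such that for every first-order Boolean doctrine $\mathbf{R}$ and Boolean doctrine morphism $(M,\mathfrak{m})\colon\mathbf{P}\to\mathbf{R}$ there is a unique first-order Boolean doctrine morphism $(N,\mathfrak{n})\colon\mathbf{P}^{\forall\exists}\to\mathbf{R}$ with $(N,\mathfrak{n})\circ(\mathrm{id}_{\mathsf{C}},\mathfrak{i})=(M,\mathfrak{m})$. *)

theory Defs
  imports "HOL-Algebra.Galois_Connection"
begin

section \<open>Boolean algebras\<close>

locale boolean_lattice = bounded_lattice L for L :: "'b gorder" (structure) +
  assumes meet_join_distrib:
      "\<lbrakk>x \<in> carrier L; y \<in> carrier L; z \<in> carrier L\<rbrakk>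
        \<Longrightarrow> x \<sqinter> (y \<squnion> z) = (x \<sqinter> y) \<squnion> (x \<sqinter> z)"
    and complement_exists:
      "x \<in> carrier L \<Longrightarrow> \<exists>y \<in> carrier L. x \<sqinter> y = \<bottom> \<and> x \<squnion> y = \<top>"

definition neg :: "'b gorder \<Rightarrow> 'b \<Rightarrow> 'b" where
  "neg L x = (THE y. y \<in> carrier L \<and> x \<sqinter>\<^bsub>L\<^esub> y = \<bottom>\<^bsub>L\<^esub> \<and> x \<squnion>\<^bsub>L\<^esub> y = \<top>\<^bsub>L\<^esub>)"

definition boolean_hom :: "'b gorder \<Rightarrow> 'c gorder \<Rightarrow> ('b \<Rightarrow> 'c) \<Rightarrow> bool" where
  "boolean_hom A B f \<longleftrightarrow>
     f \<in> carrier A \<rightarrow> carrier B \<and>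
     (\<forall>x \<in> carrier A. \<forall>y \<in> carrier A. f (x \<sqinter>\<^bsub>A\<^esub> y) = f x \<sqinter>\<^bsub>B\<^esub> f y) \<and>
     (\<forall>x \<in> carrier A. \<forall>y \<in> carrier A. f (x \<squnion>\<^bsub>A\<^esub> y) = f x \<squnion>\<^bsub>B\<^esub> f y) \<and>
     f \<bottom>\<^bsub>A\<^esub> = \<bottom>\<^bsub>B\<^esub> \<and> f \<top>\<^bsub>A\<^esub> = \<top>\<^bsub>B\<^esub> \<and>
     (\<forall>x \<in> carrier A. f (neg A x) = neg B (f x))"


section \<open>Categories with finite products\<close>

text \<open>
  Finite products are chosen: \<open>Prd C Xs\<close> is the product of the list \<open>Xs\<close> (the terminal object if
  \<open>Xs\<close> is empty) and \<open>Prj C Xs i\<close> its projection to \<open>Xs ! i\<close>, counting from 0.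
  \<open>Cmp C g f\<close> is the composite of \<open>f\<close> followed by \<open>g\<close>.
\<close>

record ('o, 'a) fpcat =
  Obj :: "'o set"
  Arr :: "'a set"
  Dom :: "'a \<Rightarrow> 'o"
  Cod :: "'a \<Rightarrow> 'o"
  Idn :: "'o \<Rightarrow> 'a"
  Cmp :: "'a \<Rightarrow> 'a \<Rightarrow> 'a"
  Prd :: "'o list \<Rightarrow> 'o"
  Prj :: "'o list \<Rightarrow> nat \<Rightarrow> 'a"

definition Hom :: "('o, 'a) fpcat \<Rightarrow> 'o \<Rightarrow> 'o \<Rightarrow> 'a set" where
  "Hom C X Y = {f \<in> Arr C. Dom C f = X \<and> Cod C f = Y}"

definition is_product ::
    "('o, 'a) fpcat \<Rightarrow> 'o list \<Rightarrow> 'o \<Rightarrow> (nat \<Rightarrow> 'a) \<Rightarrow> bool" where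
  "is_product C Xs K p \<longleftrightarrow>
     K \<in> Obj C \<and> (\<forall>i < length Xs. p i \<in> Hom C K (Xs ! i)) \<and>
     (\<forall>T \<in> Obj C. \<forall>f. (\<forall>i < length Xs. f i \<in> Hom C T (Xs ! i)) \<longrightarrow>
        (\<exists>!h. h \<in> Hom C T K \<and> (\<forall>i < length Xs. Cmp C (p i) h = f i)))"

locale fp_category =
  fixes C :: "('o, 'a) fpcat"
  assumes Dom_in: "f \<in> Arr C \<Longrightarrow> Dom C f \<in> Obj C"
    and Cod_in: "f \<in> Arr C \<Longrightarrow> Cod C f \<in> Obj C"
    and Idn_in: "X \<in> Obj C \<Longrightarrow> Idn C X \<in> Hom C X X"
    and Cmp_in: "\<lbrakk>f \<in> Hom C X Y; g \<in> Hom C Y Z\<rbrakk> \<Longrightarrow> Cmp C g f \<in> Hom C X Z"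
    and Cmp_Idn_right: "f \<in> Hom C X Y \<Longrightarrow> Cmp C f (Idn C X) = f"
    and Cmp_Idn_left: "f \<in> Hom C X Y \<Longrightarrow> Cmp C (Idn C Y) f = f"
    and Cmp_assoc: "\<lbrakk>f \<in> Hom C X Y; g \<in> Hom C Y Z; h \<in> Hom C Z W\<rbrakk>
      \<Longrightarrow> Cmp C h (Cmp C g f) = Cmp C (Cmp C h g) f"
    and product: "set Xs \<subseteq> Obj C \<Longrightarrow> is_product C Xs (Prd C Xs) (Prj C Xs)"

definition pairing :: "('o, 'a) fpcat \<Rightarrow> 'a \<Rightarrow> 'a \<Rightarrow> 'a" where
  "pairing C f g =
     (THE h. h \<in> Hom C (Dom C f) (Prd C [Cod C f, Cod C g]) \<and>
        Cmp C (Prj C [Cod C f, Cod C g] 0) h = f \<and>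
        Cmp C (Prj C [Cod C f, Cod C g] 1) h = g)"

definition times_id :: "('o, 'a) fpcat \<Rightarrow> 'a \<Rightarrow> 'o \<Rightarrow> 'a" where
  "times_id C f Y =
     pairing C (Cmp C f (Prj C [Dom C f, Y] 0)) (Cmp C (Idn C Y) (Prj C [Dom C f, Y] 1))"


section \<open>Boolean doctrines\<close>

record ('o, 'a, 'b) doctrine =
  Base :: "('o, 'a) fpcat"
  Fib :: "'o \<Rightarrow> 'b gorder"
  Rdx :: "'a \<Rightarrow> 'b \<Rightarrow> 'b"

locale boolean_doctrine =
  fixes P :: "('o, 'a, 'b) doctrine"
  assumes base: "fp_category (Base P)"
    and fib: "X \<in> Obj (Base P) \<Longrightarrow> boolean_lattice (Fib P X)"
    and rdx: "f \<in> Hom (Base P) X Y \<Longrightarrow> boolean_hom (Fib P Y) (Fib P X) (Rdx P f)"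
    and rdx_Idn: "\<lbrakk>X \<in> Obj (Base P); \<phi> \<in> carrier (Fib P X)\<rbrakk> \<Longrightarrow> Rdx P (Idn (Base P) X) \<phi> = \<phi>"
    and rdx_Cmp: "\<lbrakk>f \<in> Hom (Base P) X Y; g \<in> Hom (Base P) Y Z; \<phi> \<in> carrier (Fib P Z)\<rbrakk>
      \<Longrightarrow> Rdx P (Cmp (Base P) g f) \<phi> = Rdx P f (Rdx P g \<phi>)"

text \<open>
  \<open>forall_along P p\<close> is the right adjoint of reindexing along \<open>p\<close>, when there is one. It is then
  unique on the carrier of the fibre over the domain of \<open>p\<close>.
\<close>

definition forall_along :: "('o, 'a, 'b) doctrine \<Rightarrow> 'a \<Rightarrow> 'b \<Rightarrow> 'b" where
  "forall_along P p = (SOME g. galois_connection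
     \<lparr>orderA = Fib P (Cod (Base P) p), orderB = Fib P (Dom (Base P) p),
      lower = Rdx P p, upper = g\<rparr>)"

definition forall_q :: "('o, 'a, 'b) doctrine \<Rightarrow> 'o \<Rightarrow> 'o \<Rightarrow> 'b \<Rightarrow> 'b" where
  "forall_q P X Y = forall_along P (Prj (Base P) [X, Y] 0)"

definition exists_q :: "('o, 'a, 'b) doctrine \<Rightarrow> 'o \<Rightarrow> 'o \<Rightarrow> 'b \<Rightarrow> 'b" where
  "exists_q P X Y \<phi> = neg (Fib P X) (forall_q P X Y (neg (Fib P (Prd (Base P) [X, Y])) \<phi>))"

locale fo_boolean_doctrine = boolean_doctrine P for P :: "('o, 'a, 'b) doctrine" +
  assumes right_adjoint: "\<lbrakk>X \<in> Obj (Base P); Y \<in> Obj (Base P)\<rbrakk>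
      \<Longrightarrow> lower_adjoint (Fib P X) (Fib P (Prd (Base P) [X, Y])) (Rdx P (Prj (Base P) [X, Y] 0))"
    and beck_chevalley:
      "\<lbrakk>X \<in> Obj (Base P); X' \<in> Obj (Base P); Y \<in> Obj (Base P); f \<in> Hom (Base P) X' X;
        \<phi> \<in> carrier (Fib P (Prd (Base P) [X, Y]))\<rbrakk>
      \<Longrightarrow> Rdx P f (forall_q P X Y \<phi>) = forall_q P X' Y (Rdx P (times_id (Base P) f Y) \<phi>)"


section \<open>Morphisms of doctrines\<close>

record ('o, 'a, 'b, 'd, 'e, 'r) doctrine_map =
  On_Obj :: "'o \<Rightarrow> 'd"
  On_Arr :: "'a \<Rightarrow> 'e"
  On_Fib :: "'o \<Rightarrow> 'b \<Rightarrow> 'r"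

locale boolean_doctrine_morphism =
  fixes P :: "('o, 'a, 'b) doctrine" and R :: "('d, 'e, 'r) doctrine"
    and F :: "('o, 'a, 'b, 'd, 'e, 'r) doctrine_map"
  assumes on_Obj: "X \<in> Obj (Base P) \<Longrightarrow> On_Obj F X \<in> Obj (Base R)"
    and on_Arr: "f \<in> Hom (Base P) X Y \<Longrightarrow> On_Arr F f \<in> Hom (Base R) (On_Obj F X) (On_Obj F Y)"
    and on_Idn: "X \<in> Obj (Base P) \<Longrightarrow> On_Arr F (Idn (Base P) X) = Idn (Base R) (On_Obj F X)"
    and on_Cmp: "\<lbrakk>f \<in> Hom (Base P) X Y; g \<in> Hom (Base P) Y Z\<rbrakk>
      \<Longrightarrow> On_Arr F (Cmp (Base P) g f) = Cmp (Base R) (On_Arr F g) (On_Arr F f)"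
    and preserves_products: "set Xs \<subseteq> Obj (Base P)
      \<Longrightarrow> is_product (Base R) (map (On_Obj F) Xs) (On_Obj F (Prd (Base P) Xs))
            (\<lambda>i. On_Arr F (Prj (Base P) Xs i))"
    and on_Fib: "X \<in> Obj (Base P) \<Longrightarrow> boolean_hom (Fib P X) (Fib R (On_Obj F X)) (On_Fib F X)"
    and natural: "\<lbrakk>f \<in> Hom (Base P) X Y; \<phi> \<in> carrier (Fib P Y)\<rbrakk>
      \<Longrightarrow> On_Fib F X (Rdx P f \<phi>) = Rdx R (On_Arr F f) (On_Fib F Y \<phi>)"

text \<open>
  A functor preserving finite products need not send the chosen product \<open>X \<times> Y\<close> to the chosen
  product of the images. In the compatibility condition the image of \<open>X \<times> Y\<close>, with the images of
  the projections, is the product of the images, so the quantifier on the right is the right adjoint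
  of reindexing along the image of the first projection.
\<close>

locale fo_boolean_doctrine_morphism = boolean_doctrine_morphism P R F
  for P :: "('o, 'a, 'b) doctrine" and R :: "('d, 'e, 'r) doctrine"
    and F :: "('o, 'a, 'b, 'd, 'e, 'r) doctrine_map" +
  assumes on_All: "\<lbrakk>X \<in> Obj (Base P); Y \<in> Obj (Base P);
      \<phi> \<in> carrier (Fib P (Prd (Base P) [X, Y]))\<rbrakk>
    \<Longrightarrow> On_Fib F X (forall_q P X Y \<phi>) =
        forall_along R (On_Arr F (Prj (Base P) [X, Y] 0)) (On_Fib F (Prd (Base P) [X, Y]) \<phi>)"

text \<open>Equality of morphisms out of \<open>P\<close>, disregarding values outside the carriers.\<close>

definition same_morphism ::
    "('o, 'a, 'b) doctrine \<Rightarrow> ('o, 'a, 'b, 'd, 'e, 'r) doctrine_map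
      \<Rightarrow> ('o, 'a, 'b, 'd, 'e, 'r) doctrine_map \<Rightarrow> bool" where
  "same_morphism P F G \<longleftrightarrow>
     (\<forall>X \<in> Obj (Base P). On_Obj F X = On_Obj G X) \<and>
     (\<forall>f \<in> Arr (Base P). On_Arr F f = On_Arr G f) \<and>
     (\<forall>X \<in> Obj (Base P). \<forall>\<phi> \<in> carrier (Fib P X). On_Fib F X \<phi> = On_Fib G X \<phi>)"

definition compose_map ::
    "('o2, 'a2, 'b2, 'o3, 'a3, 'b3) doctrine_map \<Rightarrow> ('o1, 'a1, 'b1, 'o2, 'a2, 'b2) doctrine_map
      \<Rightarrow> ('o1, 'a1, 'b1, 'o3, 'a3, 'b3) doctrine_map" where
  "compose_map G F =
     \<lparr>On_Obj = \<lambda>X. On_Obj G (On_Obj F X),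
      On_Arr = \<lambda>f. On_Arr G (On_Arr F f),
      On_Fib = \<lambda>X \<phi>. On_Fib G (On_Obj F X) (On_Fib F X \<phi>)\<rparr>"

definition over_identity :: "('o \<Rightarrow> 'b \<Rightarrow> 'q) \<Rightarrow> ('o, 'a, 'b, 'o, 'a, 'q) doctrine_map" where
  "over_identity i = \<lparr>On_Obj = (\<lambda>X. X), On_Arr = (\<lambda>f. f), On_Fib = i\<rparr>"


section \<open>Quantifier completions\<close>

text \<open>
  HOL cannot quantify over types inside a formula, so the universal property is relative to a
  universe of test doctrines, given by the first argument: \<open>R\<close> ranges over all first-order Boolean
  doctrines over all categories whose objects, arrows and fibre elements are taken from the types
  \<open>'d\<close>, \<open>'e\<close> and \<open>'r\<close>. The universe has to be large compared with the base category, which is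
  where smallness of the base enters: without room for enough test doctrines the universal property
  says nothing. A universe of the form \<open>('o + 'd, 'a + 'e, 'a set + 'r) doctrine\<close> has copies of the
  base and of all sets of arrows of the base, and is otherwise arbitrary, since \<open>'d\<close>, \<open>'e\<close> and
  \<open>'r\<close> can be any types.
\<close>

definition quantifier_completion ::
    "('d, 'e, 'r) doctrine itself \<Rightarrow> ('o, 'a, 'b) doctrine \<Rightarrow> ('o, 'a, 'q) doctrine
      \<Rightarrow> ('o \<Rightarrow> 'b \<Rightarrow> 'q) \<Rightarrow> bool" where
  "quantifier_completion (_ :: ('d, 'e, 'r) doctrine itself) P Q i \<longleftrightarrow>
     Base Q = Base P \<and> fo_boolean_doctrine Q \<and>
     boolean_doctrine_morphism P Q (over_identity i) \<and>
     (\<forall>(R :: ('d, 'e, 'r) doctrine) M.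
        fo_boolean_doctrine R \<and> boolean_doctrine_morphism P R M \<longrightarrow>
        (\<exists>N. fo_boolean_doctrine_morphism Q R N \<and>
             same_morphism P (compose_map N (over_identity i)) M \<and>
             (\<forall>N'. fo_boolean_doctrine_morphism Q R N' \<and>
                   same_morphism P (compose_map N' (over_identity i)) M \<longrightarrow>
                   same_morphism Q N' N)))"

end

theory Submission
  imports Defs
begin

text \<open>
  A Boolean algebra has enough ultrafilters, so all inequalities are tested on ultrafilters.

  From (1) to (2): if (2) fails, then by compactness some ultrafilter \<open>U\<close> of \<open>P(K)\<close> contains all
  instances of the \<open>\<alpha>\<^sub>i\<close> at morphisms out of \<open>K\<close> and all the \<open>\<gamma>\<^sub>h\<close>, but none of the \<open>\<beta>\<^sub>j\<close> and no
  instance of a \<open>\<delta>\<^sub>k\<close>. The subsets of \<open>Hom(K, X)\<close> form a first-order Boolean doctrine over the base,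
  and \<open>\<phi> \<mapsto> {h. P(h)(\<phi>) \<in> U}\<close> is a morphism from \<open>P\<close> into it. Its extension to the quantifier
  completion refutes (1) at the element \<open>pr\<^sub>1\<close> of \<open>Hom(K, S)\<close>.

  From (2) to (1): instantiate the quantified \<open>\<alpha>\<^sub>i\<close> and \<open>\<delta>\<^sub>k\<close>, then discharge the variables ranging over \<open>Z\<^sub>j\<close> and
  \<open>W\<^sub>h\<close> one at a time by adjointness and Beck--Chevalley.
\<close>

section \<open>Ultrafilters of Boolean algebras\<close>

text \<open>The equivalence is a Herbrand theorem, and its asymmetry explains the object
  \<open>K\<close>. A universal premise over \<open>Y\<close> or an existential conclusion over
  \<open>V\<close> may be instantiated by any finite number of terms, whereas a universal conclusion
  over \<open>Z\<close> or an existential premise over \<open>W\<close> contributes exactly one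
  fresh variable. \<open>K\<close> is the context of these variables, and its projections are
  generic elements: in the model on \<open>Hom(K, -)\<close>, at the first projection, they refute
  the \<forall>\<beta> and witness the \<exists>\<gamma>. The numbers \<open>n\<close> and
  \<open>n'\<close> come from compactness, so no bound on them appears.

  The completion is known only through its universal property; there are no formulas of it to induct
  on. It is therefore probed by a semantics built from the base doctrine alone. Since
  \<open>Hom(K, -)\<close> preserves finite products, the quantifiers of that semantics are those of
  sets, and Beck-Chevalley comes from pairing.

  In the converse direction an existential premise \<exists>\<gamma> is treated as the failure of
  \<forall>\<not>\<gamma>, so that the variables over \<open>Z\<close> and \<open>W\<close> are
  discharged by one and the same argument.\<close>

definition proper_filter :: "'b gorder \<Rightarrow> 'b set \<Rightarrow> bool" where
  "proper_filter L F \<longleftrightarrow> F \<subseteq> carrier L \<and> \<top>\<^bsub>L\<^esub> \<in> F \<and> \<bottom>\<^bsub>L\<^esub> \<notin> F \<and>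
     (\<forall>x \<in> F. \<forall>y \<in> F. x \<sqinter>\<^bsub>L\<^esub> y \<in> F) \<and>
     (\<forall>x \<in> F. \<forall>y \<in> carrier L. x \<sqsubseteq>\<^bsub>L\<^esub> y \<longrightarrow> y \<in> F)"

text \<open>Phrased as a homomorphism to the two-element algebra rather than as a maximal filter:
  each connective can then be evaluated by rewriting, and inverse images under homomorphisms are
  immediate.\<close>

definition ultrafilter :: "'b gorder \<Rightarrow> 'b set \<Rightarrow> bool" where
  "ultrafilter L U \<longleftrightarrow> U \<subseteq> carrier L \<and> \<top>\<^bsub>L\<^esub> \<in> U \<and> \<bottom>\<^bsub>L\<^esub> \<notin> U \<and>
     (\<forall>x \<in> carrier L. \<forall>y \<in> carrier L. x \<sqinter>\<^bsub>L\<^esub> y \<in> U \<longleftrightarrow> x \<in> U \<and> y \<in> U) \<and>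
     (\<forall>x \<in> carrier L. \<forall>y \<in> carrier L. x \<squnion>\<^bsub>L\<^esub> y \<in> U \<longleftrightarrow> x \<in> U \<or> y \<in> U) \<and>
     (\<forall>x \<in> carrier L. neg L x \<in> U \<longleftrightarrow> x \<notin> U)"

lemma ultrafilter_simps:
  assumes "ultrafilter L U"
  shows "x \<in> U \<Longrightarrow> x \<in> carrier L" "\<top>\<^bsub>L\<^esub> \<in> U" "\<bottom>\<^bsub>L\<^esub> \<notin> U"
    "\<lbrakk>x \<in> carrier L; y \<in> carrier L\<rbrakk> \<Longrightarrow> x \<sqinter>\<^bsub>L\<^esub> y \<in> U \<longleftrightarrow> x \<in> U \<and> y \<in> U"
    "\<lbrakk>x \<in> carrier L; y \<in> carrier L\<rbrakk> \<Longrightarrow> x \<squnion>\<^bsub>L\<^esub> y \<in> U \<longleftrightarrow> x \<in> U \<or> y \<in> U"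
    "x \<in> carrier L \<Longrightarrow> neg L x \<in> U \<longleftrightarrow> x \<notin> U"
  using assms by (simp_all add: ultrafilter_def subset_iff)

context boolean_lattice
begin

lemma meet_top [simp]: "x \<in> carrier L \<Longrightarrow> x \<sqinter> \<top> = x"
  using top_meet meet_comm[of L] eq_is_equal by metis

lemma join_bottom [simp]: "x \<in> carrier L \<Longrightarrow> x \<squnion> \<bottom> = x"
  using bottom_join join_comm[of L] eq_is_equal by metis

text \<open>Distributivity rewrites \<open>y\<close> as its meet with \<open>z\<close>. Applied with
  \<open>y\<close> and \<open>z\<close> exchanged it gives uniqueness of complements; elsewhere it
  turns a vanishing meet into an inequality.\<close>

lemma le_complement:
  assumes "x \<in> carrier L" "y \<in> carrier L" "z \<in> carrier L" "y \<sqinter> x = \<bottom>" "x \<squnion> z = \<top>"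
  shows "y \<sqsubseteq> z"
proof -
  have "y = y \<sqinter> (x \<squnion> z)" using assms by simp
  also have "\<dots> = \<bottom> \<squnion> (y \<sqinter> z)" using meet_join_distrib[of y x z] assms by metis
  also have "\<dots> = y \<sqinter> z" using join_bottom join_comm[of L] assms by (metis meet_closed)
  finally show ?thesis using assms by (simp add: le_iff_join)
qed

lemma neg_complement:
  assumes x: "x \<in> carrier L"
  shows "neg L x \<in> carrier L" "x \<sqinter> neg L x = \<bottom>" "x \<squnion> neg L x = \<top>"
proof -
  obtain y where y: "y \<in> carrier L" "x \<sqinter> y = \<bottom>" "x \<squnion> y = \<top>"
    using complement_exists[OF x] by blast
  have "neg L x \<in> carrier L \<and> x \<sqinter> neg L x = \<bottom> \<and> x \<squnion> neg L x = \<top>"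
    unfolding neg_def
  proof (rule theI[where a = y])
    show "z = y" if "z \<in> carrier L \<and> x \<sqinter> z = \<bottom> \<and> x \<squnion> z = \<top>" for z
      using that y x le_complement[of x z y] le_complement[of x y z] meet_comm[of L]
      by (metis le_antisym)
  qed (use y in auto)
  then show "neg L x \<in> carrier L" "x \<sqinter> neg L x = \<bottom>" "x \<squnion> neg L x = \<top>" by auto
qed

lemma neg_equality:
  assumes "x \<in> carrier L" "y \<in> carrier L" "x \<sqinter> y = \<bottom>" "x \<squnion> y = \<top>"
  shows "neg L x = y"
  using assms neg_complement[of x] le_complement[of x y "neg L x"] le_complement[of x "neg L x" y]
    meet_comm[of L] by (metis le_antisym)

section \<open>Finite meets and joins, including the empty ones\<close>

lemma finite_inf_is_glb:
  assumes "finite A" "A \<subseteq> carrier L"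
  shows "greatest L (\<Sqinter>A) (Lower L A)"
proof (cases "A = {}")
  case True
  \<comment> \<open>Every element is a lower bound of the empty set, so the top is a witness for the
    choice behind the empty meet. Empty families do occur: any of the index bounds may be 0.\<close>
  then show ?thesis using top_greatest Lower_empty by (metis inf_def someI)
qed (use assms finite_inf_greatest in auto)

lemma finite_sup_is_lub:
  assumes "finite A" "A \<subseteq> carrier L"
  shows "least L (\<Squnion>A) (Upper L A)"
proof (cases "A = {}")
  case True
  then show ?thesis using bottom_least Upper_empty by (metis sup_def someI)
qed (use assms finite_sup_least in auto)

lemma finite_inf_facts:
  assumes "finite A" "A \<subseteq> carrier L"
  shows "\<Sqinter>A \<in> carrier L" "x \<in> A \<Longrightarrow> \<Sqinter>A \<sqsubseteq> x"
    "\<lbrakk>y \<in> carrier L; \<And>x. x \<in> A \<Longrightarrow> y \<sqsubseteq> x\<rbrakk> \<Longrightarrow> y \<sqsubseteq> \<Sqinter>A"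
  using finite_inf_is_glb[OF assms] assms(2) unfolding greatest_def Lower_def by auto

lemma finite_sup_facts:
  assumes "finite A" "A \<subseteq> carrier L"
  shows "\<Squnion>A \<in> carrier L" "x \<in> A \<Longrightarrow> x \<sqsubseteq> \<Squnion>A"
    "\<lbrakk>y \<in> carrier L; \<And>x. x \<in> A \<Longrightarrow> x \<sqsubseteq> y\<rbrakk> \<Longrightarrow> \<Squnion>A \<sqsubseteq> y"
  using finite_sup_is_lub[OF assms] assms(2) unfolding least_def Upper_def by auto

lemma finite_inf_insert:
  assumes "finite A" "A \<subseteq> carrier L" "x \<in> carrier L"
  shows "\<Sqinter>(insert x A) = x \<sqinter> \<Sqinter>A"
proof (rule le_antisym)
  note [simp] = finite_inf_facts(1)[OF assms(1,2)] finite_inf_facts(1)[of "insert x A"]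
  show c: "\<Sqinter>(insert x A) \<in> carrier L" "x \<sqinter> \<Sqinter>A \<in> carrier L" using assms by auto
  show "\<Sqinter>(insert x A) \<sqsubseteq> x \<sqinter> \<Sqinter>A"
    using assms c finite_inf_facts[of A] finite_inf_facts(2)[of "insert x A"] by (intro meet_le) auto
  show "x \<sqinter> \<Sqinter>A \<sqsubseteq> \<Sqinter>(insert x A)"
  proof (rule finite_inf_facts(3))
    show "x \<sqinter> \<Sqinter>A \<sqsubseteq> y" if "y \<in> insert x A" for y
      using that
    proof
      assume "y \<in> A"
      then have "x \<sqinter> \<Sqinter>A \<sqsubseteq> \<Sqinter>A" "\<Sqinter>A \<sqsubseteq> y"
        using assms meet_right finite_inf_facts[of A] by auto
      then show ?thesis
        using le_trans[of "x \<sqinter> \<Sqinter>A" "\<Sqinter>A" y] c assms \<open>y \<in> A\<close> by auto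
    qed (use assms meet_left in auto)
  qed (use assms c in auto)
qed

lemma finite_sup_insert:
  assumes "finite A" "A \<subseteq> carrier L" "x \<in> carrier L"
  shows "\<Squnion>(insert x A) = x \<squnion> \<Squnion>A"
proof (rule le_antisym)
  note [simp] = finite_sup_facts(1)[OF assms(1,2)] finite_sup_facts(1)[of "insert x A"]
  show c: "\<Squnion>(insert x A) \<in> carrier L" "x \<squnion> \<Squnion>A \<in> carrier L" using assms by auto
  show "x \<squnion> \<Squnion>A \<sqsubseteq> \<Squnion>(insert x A)"
    using assms c finite_sup_facts[of A] finite_sup_facts(2)[of "insert x A"] by (intro join_le) auto
  show "\<Squnion>(insert x A) \<sqsubseteq> x \<squnion> \<Squnion>A"
  proof (rule finite_sup_facts(3))
    show "y \<sqsubseteq> x \<squnion> \<Squnion>A" if "y \<in> insert x A" for y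
      using that
    proof
      assume "y \<in> A"
      then have "\<Squnion>A \<sqsubseteq> x \<squnion> \<Squnion>A" "y \<sqsubseteq> \<Squnion>A"
        using assms join_right finite_sup_facts[of A] by auto
      then show ?thesis
        using le_trans[of y "\<Squnion>A" "x \<squnion> \<Squnion>A"] c assms \<open>y \<in> A\<close> by auto
    qed (use assms join_left in auto)
  qed (use assms c in auto)
qed

lemma ultrafilter_meet_neg_iff:
  assumes "ultrafilter L U" "x \<in> carrier L" "y \<in> carrier L"
  shows "x \<sqinter> neg L y \<in> U \<longleftrightarrow> x \<in> U \<and> y \<notin> U"
  using ultrafilter_simps(4)[OF assms(1,2) neg_complement(1)[OF assms(3)]]
    ultrafilter_simps(6)[OF assms(1,3)] by simp

lemma ultrafilter_mono:
  assumes "ultrafilter L U" "x \<in> U" "x \<sqsubseteq> y" "y \<in> carrier L"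
  shows "y \<in> U"
proof -
  have x: "x \<in> carrier L" using ultrafilter_simps(1)[OF assms(1)] assms(2) .
  then have "x \<sqinter> y = x" using le_iff_join[of x y] assms by simp
  then show ?thesis using ultrafilter_simps(4)[OF assms(1) x assms(4)] assms(2) by simp
qed

lemma ultrafilter_inf_iff:
  assumes U: "ultrafilter L U" and "finite A" "A \<subseteq> carrier L"
  shows "\<Sqinter>A \<in> U \<longleftrightarrow> A \<subseteq> U"
  using assms(2,3)
proof (induction)
  case empty
  have "\<Sqinter>{} = \<top>" using finite_inf_facts[of "{}"] by (auto intro!: top_eq finite_inf_facts(3))
  then show ?case using ultrafilter_simps[OF U] by simp
next
  case (insert x A)
  then show ?case
    using finite_inf_insert[of A x] finite_inf_facts(1)[of A] ultrafilter_simps(4)[OF U] by auto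
qed

lemma ultrafilter_sup_iff:
  assumes U: "ultrafilter L U" and "finite A" "A \<subseteq> carrier L"
  shows "\<Squnion>A \<in> U \<longleftrightarrow> (\<exists>x \<in> A. x \<in> U)"
  using assms(2,3)
proof (induction)
  case empty
  have "\<Squnion>{} = \<bottom>" using finite_sup_facts[of "{}"] by (auto intro!: bottom_eq finite_sup_facts(3))
  then show ?case using ultrafilter_simps[OF U] by simp
next
  case (insert x A)
  then show ?case
    using finite_sup_insert[of A x] finite_sup_facts(1)[of A] ultrafilter_simps(5)[OF U] by auto
qed

section \<open>Existence of ultrafilters and compactness\<close>

lemma maximal_proper_filter_ultrafilter:
  assumes F: "proper_filter L F" and max: "\<And>G. \<lbrakk>proper_filter L G; F \<subseteq> G\<rbrakk> \<Longrightarrow> G = F"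
  shows "ultrafilter L F"
proof -
  have sub: "F \<subseteq> carrier L" and T: "\<top> \<in> F" and B: "\<bottom> \<notin> F"
    and I: "\<And>x y. \<lbrakk>x \<in> F; y \<in> F\<rbrakk> \<Longrightarrow> x \<sqinter> y \<in> F"
    and M: "\<And>x y. \<lbrakk>x \<in> F; x \<sqsubseteq> y; y \<in> carrier L\<rbrakk> \<Longrightarrow> y \<in> F"
    using F unfolding proper_filter_def by auto
  have dec: "neg L x \<in> F" if x: "x \<in> carrier L" "x \<notin> F" for x
  proof -
    \<comment> \<open>\<open>G\<close> is the filter generated by \<open>F\<close> and
      \<open>x\<close>. By maximality it is improper, so some \<open>f\<close> in \<open>F\<close>
      is disjoint from \<open>x\<close>, hence below the complement of \<open>x\<close>.\<close>
    define G where "G = {y \<in> carrier L. \<exists>f \<in> F. f \<sqinter> x \<sqsubseteq> y}"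
    have "F \<subseteq> G" unfolding G_def using sub x meet_left by blast
    moreover have "x \<in> G" unfolding G_def using T x meet_right by blast
    ultimately have "\<not> proper_filter L G" using max x by blast
    moreover have "u \<sqinter> v \<in> G" if "u \<in> G" "v \<in> G" for u v
    proof -
      obtain f g where fg: "f \<in> F" "g \<in> F" "f \<sqinter> x \<sqsubseteq> u" "g \<sqinter> x \<sqsubseteq> v" and c: "u \<in> carrier L" "v \<in> carrier L"
        using \<open>u \<in> G\<close> \<open>v \<in> G\<close> unfolding G_def by auto
      have c': "f \<in> carrier L" "g \<in> carrier L" using fg sub by auto
      have "(f \<sqinter> g) \<sqinter> x \<sqsubseteq> f \<sqinter> x" "(f \<sqinter> g) \<sqinter> x \<sqsubseteq> g \<sqinter> x"
        using c' x by (meson le_trans meet_closed meet_le meet_left meet_right)+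
      then have "(f \<sqinter> g) \<sqinter> x \<sqsubseteq> u \<sqinter> v"
        using fg c c' x by (meson le_trans meet_closed meet_le)
      moreover have "f \<sqinter> g \<in> F" "u \<sqinter> v \<in> carrier L" using I fg c by auto
      ultimately show ?thesis unfolding G_def by blast
    qed
    moreover have "v \<in> G" if "u \<in> G" "v \<in> carrier L" "u \<sqsubseteq> v" for u v
    proof -
      obtain f where f: "f \<in> F" "f \<sqinter> x \<sqsubseteq> u" "u \<in> carrier L" using \<open>u \<in> G\<close> unfolding G_def by blast
      then have "f \<sqinter> x \<sqsubseteq> v" using le_trans[of "f \<sqinter> x" u v] that sub x by auto
      then show ?thesis unfolding G_def using f that by blast
    qed
    moreover have "G \<subseteq> carrier L" "\<top> \<in> G"
      using \<open>F \<subseteq> G\<close> T unfolding G_def by auto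
    ultimately have "\<bottom> \<in> G" unfolding proper_filter_def by blast
    then obtain f where f: "f \<in> F" "f \<sqinter> x \<sqsubseteq> \<bottom>" unfolding G_def by blast
    then have "f \<sqinter> x = \<bottom>" using sub x by (meson bottom_closed bottom_lower le_antisym meet_closed subsetD)
    then have "f \<sqsubseteq> neg L x" using le_complement[of x f "neg L x"] neg_complement[of x] sub f x by auto
    then show ?thesis using M f neg_complement x by blast
  qed
  have N: "neg L x \<in> F \<longleftrightarrow> x \<notin> F" if "x \<in> carrier L" for x
    using dec[OF that] I[of x "neg L x"] neg_complement(2)[OF that] B by metis
  have J: "x \<sqinter> y \<in> F \<longleftrightarrow> x \<in> F \<and> y \<in> F" if "x \<in> carrier L" "y \<in> carrier L" for x y
    using I[of x y] M[of "x \<sqinter> y" x] M[of "x \<sqinter> y" y] meet_left[of x y] meet_right[of x y] that by metis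
  have "x \<squnion> y \<in> F \<longleftrightarrow> x \<in> F \<or> y \<in> F" if c: "x \<in> carrier L" "y \<in> carrier L" for x y
  proof
    assume xy: "x \<squnion> y \<in> F"
    show "x \<in> F \<or> y \<in> F"
    proof (rule disjCI)
      assume "y \<notin> F"
      then have n: "neg L y \<in> F" using dec c by blast
      have nc: "neg L y \<in> carrier L" using neg_complement c by blast
      have "neg L y \<sqinter> (x \<squnion> y) = (neg L y \<sqinter> x) \<squnion> (neg L y \<sqinter> y)"
        using meet_join_distrib c nc by blast
      also have "\<dots> = neg L y \<sqinter> x" using neg_complement(2)[OF c(2)] meet_comm[of L] c nc by simp
      finally have "neg L y \<sqinter> x \<in> F" using I n xy by metis
      then show "x \<in> F" using J c nc by blast
    qed
  qed (use M[of x "x \<squnion> y"] M[of y "x \<squnion> y"] join_left[of x y] join_right[of x y] c in auto)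
  then show ?thesis unfolding ultrafilter_def using sub T B N J by blast
qed

text \<open>Zorn's lemma applies because any two elements of the union of a chain already lie in one
  filter of the chain, which then contains their meet.\<close>

lemma proper_filter_extends:
  assumes "proper_filter L F"
  shows "\<exists>U. ultrafilter L U \<and> F \<subseteq> U"
proof -
  let ?A = "{G. proper_filter L G \<and> F \<subseteq> G}"
  have "\<exists>M\<in>?A. \<forall>X\<in>?A. M \<subseteq> X \<longrightarrow> X = M"
  proof (rule subset_Zorn_nonempty)
    show "\<Union>\<C> \<in> ?A" if ne: "\<C> \<noteq> {}" and ch: "subset.chain ?A \<C>" for \<C>
    proof -
      have C: "\<And>G. G \<in> \<C> \<Longrightarrow> proper_filter L G \<and> F \<subseteq> G"
        and lin: "\<And>G H. \<lbrakk>G \<in> \<C>; H \<in> \<C>\<rbrakk> \<Longrightarrow> G \<subseteq> H \<or> H \<subseteq> G"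
        using ch unfolding subset_chain_def by blast+
      have "x \<sqinter> y \<in> \<Union>\<C>" if xy: "x \<in> \<Union>\<C>" "y \<in> \<Union>\<C>" for x y
      proof -
        obtain G H where GH: "G \<in> \<C>" "H \<in> \<C>" "x \<in> G" "y \<in> H" using xy by blast
        then obtain E where "E \<in> \<C>" "x \<in> E" "y \<in> E" using lin[of G H] by blast
        then show ?thesis using C[of E] unfolding proper_filter_def by blast
      qed
      moreover have "y \<in> \<Union>\<C>" if "x \<in> \<Union>\<C>" "y \<in> carrier L" "x \<sqsubseteq> y" for x y
        using that C unfolding proper_filter_def by blast
      moreover have "\<top> \<in> \<Union>\<C>" "\<bottom> \<notin> \<Union>\<C>" "\<Union>\<C> \<subseteq> carrier L" "F \<subseteq> \<Union>\<C>"
        using ne C unfolding proper_filter_def by blast+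
      ultimately show ?thesis unfolding proper_filter_def by blast
    qed
  qed (use assms in auto)
  then obtain M where M: "proper_filter L M" "F \<subseteq> M"
    and max: "\<forall>X\<in>?A. M \<subseteq> X \<longrightarrow> X = M" by (elim bexE CollectE conjE)
  have "ultrafilter L M"
    using M max by (intro maximal_proper_filter_ultrafilter) auto
  then show ?thesis using M by blast
qed

lemma finite_inf_property_ultrafilter:
  assumes A: "A \<subseteq> carrier L"
    and fip: "\<And>F. \<lbrakk>finite F; F \<subseteq> A\<rbrakk> \<Longrightarrow> \<Sqinter>F \<noteq> \<bottom>"
  shows "\<exists>U. ultrafilter L U \<and> A \<subseteq> U"
proof -
  \<comment> \<open>The filter generated by \<open>A\<close>. The empty \<open>F\<close> puts the
    top into it; for this \<open>F\<close> the assumption \<open>fip\<close> says that the algebra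
    is not trivial.\<close>
  define G where "G = {y \<in> carrier L. \<exists>F. finite F \<and> F \<subseteq> A \<and> \<Sqinter>F \<sqsubseteq> y}"
  have c: "\<And>F. \<lbrakk>finite F; F \<subseteq> A\<rbrakk> \<Longrightarrow> \<Sqinter>F \<in> carrier L" using finite_inf_facts(1) A by blast
  have AG: "A \<subseteq> G"
  proof
    fix x assume x: "x \<in> A"
    then have "\<Sqinter>{x} \<sqsubseteq> x" using A by (intro finite_inf_facts(2)) auto
    then show "x \<in> G" unfolding G_def using x A by blast
  qed
  have "u \<sqinter> v \<in> G" if uv: "u \<in> G" "v \<in> G" for u v
  proof -
    obtain E F where EF: "finite E" "E \<subseteq> A" "\<Sqinter>E \<sqsubseteq> u" "finite F" "F \<subseteq> A" "\<Sqinter>F \<sqsubseteq> v"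
      and uvc: "u \<in> carrier L" "v \<in> carrier L"
      using uv unfolding G_def by blast
    have mono: "\<Sqinter>(E \<union> F) \<sqsubseteq> \<Sqinter>H" if "H \<subseteq> E \<union> F" for H
    proof -
      have fin: "finite (E \<union> F)" "finite H" using EF that finite_subset[of H "E \<union> F"] by auto
      have sub: "E \<union> F \<subseteq> carrier L" "H \<subseteq> carrier L" using EF(2,5) that A by blast+
      show ?thesis
        using finite_inf_facts[OF fin(1) sub(1)] that by (intro finite_inf_facts(3)[OF fin(2) sub(2)]) auto
    qed
    have EFc: "finite (E \<union> F)" "E \<union> F \<subseteq> A" using EF by auto
    have "\<Sqinter>(E \<union> F) \<sqsubseteq> u" "\<Sqinter>(E \<union> F) \<sqsubseteq> v"
      using mono[of E] mono[of F] EF c[OF EFc] c[of E] c[of F] uvc by (meson Un_upper1 Un_upper2 le_trans)+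
    then have "\<Sqinter>(E \<union> F) \<sqsubseteq> u \<sqinter> v" "u \<sqinter> v \<in> carrier L" using meet_le uvc c[OF EFc] by auto
    then show ?thesis unfolding G_def using EFc by blast
  qed
  moreover have "v \<in> G" if "u \<in> G" "v \<in> carrier L" "u \<sqsubseteq> v" for u v
  proof -
    obtain F where F: "finite F" "F \<subseteq> A" "\<Sqinter>F \<sqsubseteq> u" "u \<in> carrier L" using \<open>u \<in> G\<close> unfolding G_def by blast
    then have "\<Sqinter>F \<sqsubseteq> v" using le_trans[of "\<Sqinter>F" u v] that c by auto
    then show ?thesis unfolding G_def using F that by blast
  qed
  moreover have "\<bottom> \<notin> G"
  proof
    assume "\<bottom> \<in> G"
    then obtain F where F: "finite F" "F \<subseteq> A" "\<Sqinter>F \<sqsubseteq> \<bottom>" unfolding G_def by blast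
    then have "\<Sqinter>F = \<bottom>" using c[of F] le_antisym[of "\<Sqinter>F" \<bottom>] bottom_lower[of "\<Sqinter>F"] by simp
    then show False using fip F by blast
  qed
  moreover have "\<Sqinter>{} \<sqsubseteq> \<top>" using top_higher c[of "{}"] by simp
  then have "\<top> \<in> G" unfolding G_def using top_closed by blast
  moreover have "G \<subseteq> carrier L" unfolding G_def by blast
  ultimately have "proper_filter L G" unfolding proper_filter_def by blast
  then show ?thesis using proper_filter_extends[of G] AG by (meson order_trans)
qed

text \<open>The compactness step, obtained from the finite intersection property of \<open>A\<close>
  together with the complements of \<open>B\<close>. Read contrapositively, it extracts a finite
  sequent when no separating ultrafilter exists, and this is the origin of \<open>n\<close> and
  \<open>n'\<close>.\<close>

lemma ultrafilter_separation:
  assumes A: "A \<subseteq> carrier L" and B: "B \<subseteq> carrier L"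
    and sep: "\<And>E F. \<lbrakk>finite E; E \<subseteq> A; finite F; F \<subseteq> B\<rbrakk> \<Longrightarrow> \<not> \<Sqinter>E \<sqsubseteq> \<Squnion>F"
  shows "\<exists>U. ultrafilter L U \<and> A \<subseteq> U \<and> B \<inter> U = {}"
proof -
  have "\<exists>U. ultrafilter L U \<and> A \<union> neg L ` B \<subseteq> U"
  proof (rule finite_inf_property_ultrafilter)
    show "A \<union> neg L ` B \<subseteq> carrier L" using A B neg_complement by auto
    show "\<Sqinter>H \<noteq> \<bottom>" if H: "finite H" "H \<subseteq> A \<union> neg L ` B" for H
    proof
      assume bot: "\<Sqinter>H = \<bottom>"
      \<comment> \<open>An element of \<open>H\<close> may lie in \<open>A\<close> and also be the
        complement of an element of \<open>B\<close>; it is then counted in \<open>A\<close>, and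
        only the rest of \<open>H\<close> is traced back to \<open>B\<close>.\<close>
      obtain F where F: "F \<subseteq> B" "finite F" "H - A = neg L ` F"
        using finite_subset_image[of "H - A" "neg L" B] H by blast
      let ?E = "H \<inter> A"
      have Ec: "\<Sqinter>?E \<in> carrier L" and Fc: "\<Squnion>F \<in> carrier L"
        using finite_inf_facts(1)[of ?E] finite_sup_facts(1)[of F] H(1) F(1,2) A B by blast+
      \<comment> \<open>\<open>z\<close> lies below each member of \<open>H\<close>: below those in
        \<open>A\<close> through the meet of \<open>?E\<close>, and below the complement of
        \<open>b\<close> because \<open>b\<close> is under the join of \<open>F\<close>. So
        \<open>z\<close> vanishes, which says that the meet of \<open>?E\<close> is below the join
        of \<open>F\<close>.\<close>
      define z where "z = \<Sqinter>?E \<sqinter> neg L (\<Squnion>F)"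
      have nF: "neg L (\<Squnion>F) \<in> carrier L" using neg_complement Fc by blast
      have zc: "z \<in> carrier L" unfolding z_def using Ec nF by simp
      have "z \<sqsubseteq> \<Sqinter>H"
      proof (rule finite_inf_facts(3))
        show "H \<subseteq> carrier L" using H A B neg_complement by blast
        show "z \<sqsubseteq> x" if "x \<in> H" for x
        proof (cases "x \<in> A")
          case True
          then have "\<Sqinter>?E \<sqsubseteq> x" using finite_inf_facts(2)[of ?E] H A that by blast
          then show ?thesis unfolding z_def using meet_left Ec nF A True le_trans by (meson meet_closed subsetD)
        next
          case False
          then obtain b where b: "b \<in> F" "x = neg L b" using F(3) \<open>x \<in> H\<close> by (metis DiffI imageE)
          have bc: "b \<in> carrier L" using b(1) F(1) B by blast
          have xc: "x \<in> carrier L" using b(2) bc neg_complement(1) by simp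
          have "neg L (\<Squnion>F) \<sqinter> b \<sqsubseteq> neg L (\<Squnion>F) \<sqinter> \<Squnion>F"
            using finite_sup_facts(2)[of F b] F(1,2) B b(1) bc nF Fc
            by (intro meet_le le_trans[OF meet_right, of _ _ "\<Squnion>F"] meet_left) auto
          then have "neg L (\<Squnion>F) \<sqinter> b = \<bottom>"
            using neg_complement(2)[OF Fc] meet_comm[of L] nF bc
            by (metis bottom_closed bottom_lower le_antisym meet_closed)
          then have "neg L (\<Squnion>F) \<sqsubseteq> x"
            using le_complement[of b "neg L (\<Squnion>F)" x] neg_complement(3)[OF bc] b bc nF xc by auto
          then show ?thesis unfolding z_def using meet_right Ec nF xc le_trans by (meson meet_closed)
        qed
      qed (use H zc in auto)
      then have "z = \<bottom>" using bot zc le_antisym[of z \<bottom>] bottom_lower[of z] by simp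
      then have "\<Sqinter>?E \<sqsubseteq> \<Squnion>F"
        unfolding z_def using le_complement[of "neg L (\<Squnion>F)" "\<Sqinter>?E" "\<Squnion>F"] nF Fc Ec
          neg_complement(3)[OF Fc] join_comm[of L] by metis
      then show False using sep[of ?E F] H(1) F(1,2) by blast
    qed
  qed
  then obtain U where U: "ultrafilter L U" "A \<union> neg L ` B \<subseteq> U" by blast
  then have "B \<inter> U = {}" using ultrafilter_simps(6)[OF U(1)] B by blast
  then show ?thesis using U by blast
qed

lemma le_iff_ultrafilter:
  assumes x: "x \<in> carrier L" and y: "y \<in> carrier L"
  shows "x \<sqsubseteq> y \<longleftrightarrow> (\<forall>U. ultrafilter L U \<longrightarrow> x \<in> U \<longrightarrow> y \<in> U)"
proof
  assume R: "\<forall>U. ultrafilter L U \<longrightarrow> x \<in> U \<longrightarrow> y \<in> U"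
  show "x \<sqsubseteq> y"
  proof (rule ccontr)
    assume n: "\<not> x \<sqsubseteq> y"
    have "\<exists>U. ultrafilter L U \<and> {x} \<subseteq> U \<and> {y} \<inter> U = {}"
    proof (rule ultrafilter_separation)
      show "\<not> \<Sqinter>E \<sqsubseteq> \<Squnion>F" if "finite E" "E \<subseteq> {x}" "finite F" "F \<subseteq> {y}" for E F
      proof
        assume le: "\<Sqinter>E \<sqsubseteq> \<Squnion>F"
        have "x \<sqsubseteq> \<Sqinter>E" using that x by (intro finite_inf_facts(3)) auto
        moreover have "\<Squnion>F \<sqsubseteq> y" using that y by (intro finite_sup_facts(3)) auto
        moreover have "\<Sqinter>E \<in> carrier L" "\<Squnion>F \<in> carrier L"
          using that x y finite_inf_facts(1)[of E] finite_sup_facts(1)[of F] by auto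
        ultimately show False using n le x y le_trans by meson
      qed
    qed (use x y in auto)
    then show False using R by auto
  qed
next
  assume "x \<sqsubseteq> y"
  then show "\<forall>U. ultrafilter L U \<longrightarrow> x \<in> U \<longrightarrow> y \<in> U"
    using ultrafilter_mono[of _ x y] y by simp
qed

text \<open>The four families are those of the theorem, so the same equivalence serves for (1) in
  \<open>Fib Q S\<close> and for (2) in \<open>Fib P K\<close>.\<close>

lemma sequent_iff_ultrafilter:
  fixes a b c d :: "nat \<Rightarrow> 'b"
  assumes "\<And>u. u < na \<Longrightarrow> a u \<in> carrier L" "\<And>h. h < nc \<Longrightarrow> c h \<in> carrier L"
    "\<And>j. j < nb \<Longrightarrow> b j \<in> carrier L" "\<And>k. k < nd \<Longrightarrow> d k \<in> carrier L"
  shows "\<Sqinter>(a ` {..<na}) \<sqinter> \<Sqinter>(c ` {..<nc}) \<sqsubseteq> \<Squnion>(b ` {..<nb}) \<squnion> \<Squnion>(d ` {..<nd}) \<longleftrightarrow>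
    (\<forall>U. ultrafilter L U \<longrightarrow> (\<forall>u < na. a u \<in> U) \<longrightarrow> (\<forall>h < nc. c h \<in> U) \<longrightarrow>
      (\<exists>j < nb. b j \<in> U) \<or> (\<exists>k < nd. d k \<in> U))"
proof -
  have sub: "a ` {..<na} \<subseteq> carrier L" "c ` {..<nc} \<subseteq> carrier L"
    "b ` {..<nb} \<subseteq> carrier L" "d ` {..<nd} \<subseteq> carrier L"
    using assms by auto
  have fin: "finite (f ` {..<m})" for f :: "nat \<Rightarrow> 'b" and m :: nat by simp
  note c = finite_inf_facts(1)[OF fin sub(1)] finite_inf_facts(1)[OF fin sub(2)]
    finite_sup_facts(1)[OF fin sub(3)] finite_sup_facts(1)[OF fin sub(4)]
  have "\<Sqinter>(a ` {..<na}) \<sqinter> \<Sqinter>(c ` {..<nc}) \<in> U \<longleftrightarrow> (\<forall>u < na. a u \<in> U) \<and> (\<forall>h < nc. c h \<in> U)"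
    "\<Squnion>(b ` {..<nb}) \<squnion> \<Squnion>(d ` {..<nd}) \<in> U \<longleftrightarrow> (\<exists>j < nb. b j \<in> U) \<or> (\<exists>k < nd. d k \<in> U)"
    if U: "ultrafilter L U" for U
    using ultrafilter_simps(4)[OF U c(1,2)] ultrafilter_simps(5)[OF U c(3,4)]
      ultrafilter_inf_iff[OF U fin sub(1)] ultrafilter_inf_iff[OF U fin sub(2)]
      ultrafilter_sup_iff[OF U fin sub(3)] ultrafilter_sup_iff[OF U fin sub(4)]
    by (simp_all add: image_subset_iff Ball_def Bex_def)
  then show ?thesis
    using le_iff_ultrafilter[OF meet_closed[OF c(1,2)] join_closed[OF c(3,4)]] by (simp add: imp_conjL)
qed

end

text \<open>Composition of homomorphisms into the two-element algebra. It carries ultrafilters back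
  along reindexing, along the unit \<open>i\<close>, and along the extension of a model to the
  completion.\<close>

lemma boolean_hom_ultrafilter:
  assumes f: "boolean_hom A B f" and A: "boolean_lattice A" and U: "ultrafilter B U"
  shows "ultrafilter A {x \<in> carrier A. f x \<in> U}"
proof -
  interpret boolean_lattice A by fact
  have c: "\<And>x. x \<in> carrier A \<Longrightarrow> f x \<in> carrier B" using f unfolding boolean_hom_def by auto
  show ?thesis
    unfolding ultrafilter_def using f ultrafilter_simps[OF U] c neg_complement(1)
    by (auto simp: boolean_hom_def)
qed

section \<open>Products and quantifiers\<close>

context fp_category
begin

lemma Hom_Obj:
  assumes "f \<in> Hom C X Y"
  shows "X \<in> Obj C" "Y \<in> Obj C"
  using assms Dom_in Cod_in unfolding Hom_def by auto

lemma Prd_Obj: "set Xs \<subseteq> Obj C \<Longrightarrow> Prd C Xs \<in> Obj C"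
  using product unfolding is_product_def by blast

lemma Prj_in_Hom:
  "\<lbrakk>set Xs \<subseteq> Obj C; j < length Xs\<rbrakk> \<Longrightarrow> Prj C Xs j \<in> Hom C (Prd C Xs) (Xs ! j)"
  using product unfolding is_product_def by blast

lemma tuple_exists:
  assumes "set Xs \<subseteq> Obj C" "T \<in> Obj C" "\<And>j. j < length Xs \<Longrightarrow> f j \<in> Hom C T (Xs ! j)"
  obtains h where "h \<in> Hom C T (Prd C Xs)" "\<And>j. j < length Xs \<Longrightarrow> Cmp C (Prj C Xs j) h = f j"
proof -
  have "\<exists>!h. h \<in> Hom C T (Prd C Xs) \<and> (\<forall>j < length Xs. Cmp C (Prj C Xs j) h = f j)"
    using product[OF assms(1)] assms(2,3) unfolding is_product_def by simp
  then show ?thesis using that by blast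
qed

lemma tuple_unique:
  assumes "set Xs \<subseteq> Obj C" "h \<in> Hom C T (Prd C Xs)" "h' \<in> Hom C T (Prd C Xs)"
    "\<And>j. j < length Xs \<Longrightarrow> Cmp C (Prj C Xs j) h = Cmp C (Prj C Xs j) h'"
  shows "h = h'"
proof -
  have "\<exists>!k. k \<in> Hom C T (Prd C Xs) \<and> (\<forall>j < length Xs. Cmp C (Prj C Xs j) k = Cmp C (Prj C Xs j) h')"
    using product[OF assms(1)] Hom_Obj(1)[OF assms(3)] Cmp_in[OF assms(3) Prj_in_Hom[OF assms(1)]]
    unfolding is_product_def by simp
  then show ?thesis using assms(2-4) by blast
qed

lemma Prj_pair:
  assumes "X \<in> Obj C" "Y \<in> Obj C"
  shows "Prd C [X, Y] \<in> Obj C" "Prj C [X, Y] 0 \<in> Hom C (Prd C [X, Y]) X"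
    "Prj C [X, Y] (Suc 0) \<in> Hom C (Prd C [X, Y]) Y"
  using Prd_Obj[of "[X, Y]"] Prj_in_Hom[of "[X, Y]" 0] Prj_in_Hom[of "[X, Y]" 1] assms by auto

lemma pairing:
  assumes f: "f \<in> Hom C T X" and g: "g \<in> Hom C T Y"
  shows "pairing C f g \<in> Hom C T (Prd C [X, Y])"
    "Cmp C (Prj C [X, Y] 0) (pairing C f g) = f"
    "Cmp C (Prj C [X, Y] (Suc 0)) (pairing C f g) = g"
proof -
  have XY: "set [X, Y] \<subseteq> Obj C" and T: "T \<in> Obj C" using Hom_Obj[OF f] Hom_Obj[OF g] by auto
  have eqs: "Dom C f = T" "Cod C f = X" "Cod C g = Y" using f g unfolding Hom_def by auto
  obtain h where h: "h \<in> Hom C T (Prd C [X, Y])"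
    "\<And>j. j < length [X, Y] \<Longrightarrow> Cmp C (Prj C [X, Y] j) h = (if j = 0 then f else g)"
    by (rule tuple_exists[OF XY T, of "\<lambda>j. if j = 0 then f else g"]) (use f g in \<open>auto simp: less_Suc_eq\<close>)
  have "\<exists>!h. h \<in> Hom C T (Prd C [X, Y]) \<and>
      Cmp C (Prj C [X, Y] 0) h = f \<and> Cmp C (Prj C [X, Y] (Suc 0)) h = g"
  proof (rule ex1I[of _ h])
    show "h \<in> Hom C T (Prd C [X, Y]) \<and>
        Cmp C (Prj C [X, Y] 0) h = f \<and> Cmp C (Prj C [X, Y] (Suc 0)) h = g"
      using h(1) h(2)[of 0] h(2)[of 1] by simp
    show "k = h" if "k \<in> Hom C T (Prd C [X, Y]) \<and>
        Cmp C (Prj C [X, Y] 0) k = f \<and> Cmp C (Prj C [X, Y] (Suc 0)) k = g" for k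
      using that h by (intro tuple_unique[OF XY, of k T h]) (auto simp: less_Suc_eq)
  qed
  from theI'[OF this] show "pairing C f g \<in> Hom C T (Prd C [X, Y])"
    "Cmp C (Prj C [X, Y] 0) (pairing C f g) = f"
    "Cmp C (Prj C [X, Y] (Suc 0)) (pairing C f g) = g"
    unfolding pairing_def eqs by auto
qed

lemma pairing_unique:
  assumes h: "h \<in> Hom C T (Prd C [X, Y])" and XY: "X \<in> Obj C" "Y \<in> Obj C"
    and "Cmp C (Prj C [X, Y] 0) h = f" "Cmp C (Prj C [X, Y] (Suc 0)) h = g"
  shows "h = pairing C f g"
proof -
  have f: "f \<in> Hom C T X" and g: "g \<in> Hom C T Y"
    using Cmp_in[OF h Prj_pair(2)[OF XY]] Cmp_in[OF h Prj_pair(3)[OF XY]] assms by auto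
  show ?thesis
  proof (rule tuple_unique[OF _ h pairing(1)[OF f g]])
    show "set [X, Y] \<subseteq> Obj C" using XY by simp
    show "Cmp C (Prj C [X, Y] j) h = Cmp C (Prj C [X, Y] j) (pairing C f g)"
      if "j < length [X, Y]" for j
      using that pairing(2,3)[OF f g] assms(4,5) by (auto simp: less_Suc_eq)
  qed
qed

lemma Cmp_pairing:
  assumes f: "f \<in> Hom C T X" and g: "g \<in> Hom C T Y" and e: "e \<in> Hom C T' T"
  shows "Cmp C (pairing C f g) e = pairing C (Cmp C f e) (Cmp C g e)"
proof (rule pairing_unique)
  show XY: "X \<in> Obj C" "Y \<in> Obj C" using Hom_Obj f g by auto
  show "Cmp C (pairing C f g) e \<in> Hom C T' (Prd C [X, Y])"
    using Cmp_in[OF e pairing(1)[OF f g]] .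
  show "Cmp C (Prj C [X, Y] 0) (Cmp C (pairing C f g) e) = Cmp C f e"
    using Cmp_assoc[OF e pairing(1)[OF f g] Prj_pair(2)[OF XY]] pairing[OF f g] by simp
  show "Cmp C (Prj C [X, Y] (Suc 0)) (Cmp C (pairing C f g) e) = Cmp C g e"
    using Cmp_assoc[OF e pairing(1)[OF f g] Prj_pair(3)[OF XY]] pairing[OF f g] by simp
qed

lemma times_id_eq:
  assumes "f \<in> Hom C X' X" "Y \<in> Obj C"
  shows "times_id C f Y = pairing C (Cmp C f (Prj C [X', Y] 0)) (Prj C [X', Y] (Suc 0))"
proof -
  have "Dom C f = X'" using assms(1) unfolding Hom_def by auto
  then show ?thesis
    unfolding times_id_def using Cmp_Idn_left[OF Prj_pair(3)[OF Hom_Obj(1)[OF assms(1)] assms(2)]] by simp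
qed

end

text \<open>\<open>forall_along\<close> is a choice, and existence of a right adjoint makes the
  choice a right adjoint. The arrow \<open>p\<close> is arbitrary because a doctrine morphism need
  not send a chosen projection to a chosen projection.\<close>

lemma lower_adjoint_forall_along:
  assumes "lower_adjoint (Fib P X) (Fib P T) (Rdx P p)" "p \<in> Hom (Base P) T X"
    "\<psi> \<in> carrier (Fib P T)"
  shows "forall_along P p \<psi> \<in> carrier (Fib P X)"
    "\<phi> \<in> carrier (Fib P X) \<Longrightarrow>
       \<phi> \<sqsubseteq>\<^bsub>Fib P X\<^esub> forall_along P p \<psi> \<longleftrightarrow> Rdx P p \<phi> \<sqsubseteq>\<^bsub>Fib P T\<^esub> \<psi>"
proof -
  have "Dom (Base P) p = T" "Cod (Base P) p = X" using assms(2) unfolding Hom_def by auto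
  then have g: "galois_connection \<lparr>orderA = Fib P X, orderB = Fib P T, lower = Rdx P p,
      upper = forall_along P p\<rparr>"
    using assms(1) unfolding lower_adjoint_def forall_along_def by (metis someI)
  show "forall_along P p \<psi> \<in> carrier (Fib P X)"
    using connection.upper_closed[OF galois_connection.axioms(1)[OF g]] assms(3) by simp
  show "\<phi> \<sqsubseteq>\<^bsub>Fib P X\<^esub> forall_along P p \<psi> \<longleftrightarrow> Rdx P p \<phi> \<sqsubseteq>\<^bsub>Fib P T\<^esub> \<psi>"
    if "\<phi> \<in> carrier (Fib P X)"
    using galois_connection.galois_property[OF g] assms(3) that by simp
qed

context boolean_doctrine
begin

lemma rdx_closed:
  "\<lbrakk>f \<in> Hom (Base P) X Y; \<phi> \<in> carrier (Fib P Y)\<rbrakk> \<Longrightarrow> Rdx P f \<phi> \<in> carrier (Fib P X)"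
  using rdx[of f X Y] unfolding boolean_hom_def by auto

lemma rdx_ultrafilter:
  assumes "f \<in> Hom (Base P) X Y" "ultrafilter (Fib P X) U"
  shows "ultrafilter (Fib P Y) {\<phi> \<in> carrier (Fib P Y). Rdx P f \<phi> \<in> U}"
  using boolean_hom_ultrafilter[OF rdx[OF assms(1)] fib assms(2)] fp_category.Hom_Obj(2)[OF base assms(1)]
  by blast

lemma rdx_neg_iff:
  assumes f: "f \<in> Hom (Base P) X Y" and \<phi>: "\<phi> \<in> carrier (Fib P Y)" and U: "ultrafilter (Fib P X) U"
  shows "Rdx P f (neg (Fib P Y) \<phi>) \<in> U \<longleftrightarrow> Rdx P f \<phi> \<notin> U"
proof -
  have "Rdx P f (neg (Fib P Y) \<phi>) = neg (Fib P X) (Rdx P f \<phi>)"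
    using rdx[OF f] \<phi> unfolding boolean_hom_def by simp
  then show ?thesis using ultrafilter_simps(6)[OF U rdx_closed[OF f \<phi>]] by simp
qed

end

context fo_boolean_doctrine
begin

lemma forall_q:
  assumes "X \<in> Obj (Base P)" "Y \<in> Obj (Base P)" "\<psi> \<in> carrier (Fib P (Prd (Base P) [X, Y]))"
  shows "forall_q P X Y \<psi> \<in> carrier (Fib P X)"
    "\<phi> \<in> carrier (Fib P X) \<Longrightarrow> \<phi> \<sqsubseteq>\<^bsub>Fib P X\<^esub> forall_q P X Y \<psi> \<longleftrightarrow>
       Rdx P (Prj (Base P) [X, Y] 0) \<phi> \<sqsubseteq>\<^bsub>Fib P (Prd (Base P) [X, Y])\<^esub> \<psi>"
  unfolding forall_q_def
  using lower_adjoint_forall_along[OF right_adjoint[OF assms(1,2)]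
      fp_category.Prj_pair(2)[OF base assms(1,2)] assms(3)] by auto

lemma exists_q_iff:
  assumes "X \<in> Obj (Base P)" "Y \<in> Obj (Base P)" "\<psi> \<in> carrier (Fib P (Prd (Base P) [X, Y]))"
  shows "exists_q P X Y \<psi> \<in> carrier (Fib P X)"
    "ultrafilter (Fib P X) U \<Longrightarrow>
      exists_q P X Y \<psi> \<in> U \<longleftrightarrow> forall_q P X Y (neg (Fib P (Prd (Base P) [X, Y])) \<psi>) \<notin> U"
proof -
  let ?n = "neg (Fib P (Prd (Base P) [X, Y])) \<psi>"
  have "?n \<in> carrier (Fib P (Prd (Base P) [X, Y]))"
    using boolean_lattice.neg_complement(1)[OF fib[OF fp_category.Prj_pair(1)[OF base assms(1,2)]] assms(3)] .
  note All = forall_q(1)[OF assms(1,2) this]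
  show "exists_q P X Y \<psi> \<in> carrier (Fib P X)"
    unfolding exists_q_def by (rule boolean_lattice.neg_complement(1)[OF fib[OF assms(1)] All])
  show "exists_q P X Y \<psi> \<in> U \<longleftrightarrow> forall_q P X Y ?n \<notin> U" if "ultrafilter (Fib P X) U"
    unfolding exists_q_def using ultrafilter_simps(6)[OF that All] .
qed

text \<open>Reindexing the counit, which says that the weakening of \<forall>\<psi> lies below
  \<psi>, along \<langle>f, g\<rangle> gives the claim, since the first projection after this
  pairing is \<open>f\<close>.\<close>

lemma forall_q_instance:
  assumes f: "f \<in> Hom (Base P) T X" and g: "g \<in> Hom (Base P) T Y"
    and \<psi>: "\<psi> \<in> carrier (Fib P (Prd (Base P) [X, Y]))"
    and U: "ultrafilter (Fib P T) U" "Rdx P f (forall_q P X Y \<psi>) \<in> U"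
  shows "Rdx P (pairing (Base P) f g) \<psi> \<in> U"
proof -
  interpret C: fp_category "Base P" by (rule base)
  let ?C = "Base P" and ?h = "pairing (Base P) f g"
  have X: "X \<in> Obj ?C" and Y: "Y \<in> Obj ?C" using C.Hom_Obj f g by auto
  let ?A = "forall_q P X Y \<psi>" and ?p = "Prj ?C [X, Y] 0"
  have A: "?A \<in> carrier (Fib P X)" using forall_q(1)[OF X Y \<psi>] .
  interpret FX: boolean_lattice "Fib P X" by (rule fib[OF X])
  interpret FXY: boolean_lattice "Fib P (Prd ?C [X, Y])" by (rule fib[OF C.Prj_pair(1)[OF X Y]])
  have le: "Rdx P ?p ?A \<sqsubseteq>\<^bsub>Fib P (Prd ?C [X, Y])\<^esub> \<psi>"
    using forall_q(2)[OF X Y \<psi> A] FX.le_refl[OF A] by simp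
  have pA: "Rdx P ?p ?A \<in> carrier (Fib P (Prd ?C [X, Y]))"
    using rdx_closed[OF C.Prj_pair(2)[OF X Y] A] .
  have "Rdx P f ?A = Rdx P ?h (Rdx P ?p ?A)"
    using rdx_Cmp[OF C.pairing(1)[OF f g] C.Prj_pair(2)[OF X Y] A] C.pairing(2)[OF f g] by simp
  then have "Rdx P ?p ?A \<in> {\<phi> \<in> carrier (Fib P (Prd ?C [X, Y])). Rdx P ?h \<phi> \<in> U}"
    using U(2) pA by simp
  from FXY.ultrafilter_mono[OF rdx_ultrafilter[OF C.pairing(1)[OF f g] U(1)] this le \<psi>]
  show ?thesis by simp
qed

text \<open>
  The inductive step moves the negation of \<open>\<forall>\<theta>\<close>, for the last disjunct \<open>\<theta>\<close>, into \<open>\<phi>\<close>.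
\<close>

lemma forall_q_disjunction:
  fixes Ts :: "('o \<times> 'b) list"
  assumes "S \<in> Obj (Base P)"
    and "\<And>X \<theta>. (X, \<theta>) \<in> set Ts \<Longrightarrow> X \<in> Obj (Base P) \<and> \<theta> \<in> carrier (Fib P (Prd (Base P) [S, X]))"
    and "\<phi> \<in> carrier (Fib P S)"
    and "\<And>U. \<lbrakk>ultrafilter (Fib P (Prd (Base P) (S # map fst Ts))) U;
            Rdx P (Prj (Base P) (S # map fst Ts) 0) \<phi> \<in> U\<rbrakk> \<Longrightarrow>
          \<exists>j < length Ts. Rdx P (pairing (Base P) (Prj (Base P) (S # map fst Ts) 0)
             (Prj (Base P) (S # map fst Ts) (Suc j))) (snd (Ts ! j)) \<in> U"
    and "ultrafilter (Fib P S) U" "\<phi> \<in> U"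
  shows "\<exists>j < length Ts. forall_q P S (fst (Ts ! j)) (snd (Ts ! j)) \<in> U"
  using assms
proof (induction Ts arbitrary: \<phi> U rule: rev_induct)
  case Nil
  interpret C: fp_category "Base P" by (rule base)
  have S: "set [S] \<subseteq> Obj (Base P)" using Nil by simp
  \<comment> \<open>The product of the one-element list \<open>[S]\<close> is not literally
    \<open>S\<close>; \<open>e\<close> is the section of its projection. Pulling \<open>U\<close>
    back along \<open>e\<close> makes the hypothesis produce an index below 0.\<close>
  obtain e where e: "e \<in> Hom (Base P) S (Prd (Base P) [S])"
    "\<And>j. j < length [S] \<Longrightarrow> Cmp (Base P) (Prj (Base P) [S] j) e = Idn (Base P) S"
    by (rule C.tuple_exists[OF S Nil(1), of "\<lambda>_. Idn (Base P) S"]) (use C.Idn_in[OF Nil(1)] in auto)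
  have p: "Prj (Base P) [S] 0 \<in> Hom (Base P) (Prd (Base P) [S]) S" using C.Prj_in_Hom[OF S, of 0] by simp
  have "Rdx P e (Rdx P (Prj (Base P) [S] 0) \<phi>) = \<phi>"
    using rdx_Cmp[OF e(1) p Nil(3)] e(2)[of 0] rdx_Idn Nil(1,3) by simp
  then show ?case
    using Nil(4)[of "{\<phi> \<in> carrier (Fib P (Prd (Base P) [S])). Rdx P e \<phi> \<in> U}"] rdx_ultrafilter[OF e(1) Nil(5)]
      rdx_closed[OF p Nil(3)] Nil(6) by simp
next
  case (snoc T Ts)
  interpret C: fp_category "Base P" by (rule base)
  obtain X \<theta> where T: "T = (X, \<theta>)" by fastforce
  note S = snoc.prems(1) and \<phi> = snoc.prems(3) and hyp = snoc.prems(4)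
  let ?C = "Base P" let ?Xs = "S # map fst Ts" let ?Xs' = "S # map fst (Ts @ [T])"
  let ?K = "Prd ?C ?Xs" and ?K' = "Prd ?C ?Xs'" let ?n = "length Ts"
  let ?KX = "Prd ?C [?K, X]"
  have X: "X \<in> Obj ?C" and \<theta>: "\<theta> \<in> carrier (Fib P (Prd ?C [S, X]))" using snoc.prems(2) T by auto
  have Tj: "fst (Ts ! j) \<in> Obj ?C" "snd (Ts ! j) \<in> carrier (Fib P (Prd ?C [S, fst (Ts ! j)]))"
    if "j < ?n" for j
    using snoc.prems(2)[of "fst (Ts ! j)" "snd (Ts ! j)"] that by auto
  have Xs: "set ?Xs \<subseteq> Obj ?C" and Xs': "set ?Xs' \<subseteq> Obj ?C"
    using S X T snoc.prems(2)[of "fst t" "snd t" for t] by (auto simp: image_subset_iff)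
  have K: "?K \<in> Obj ?C" using C.Prd_Obj[OF Xs] .
  note KX = C.Prj_pair[OF K X]
  let ?p = "Prj ?C [?K, X] 0" and ?q = "Prj ?C [?K, X] (Suc 0)"
  have pr0: "Prj ?C ?Xs 0 \<in> Hom ?C ?K S" using C.Prj_in_Hom[OF Xs, of 0] by simp
  have prj: "Prj ?C ?Xs (Suc j) \<in> Hom ?C ?K (fst (Ts ! j))" if "j < ?n" for j
    using C.Prj_in_Hom[OF Xs, of "Suc j"] that by simp
  have pr0': "Prj ?C ?Xs' 0 \<in> Hom ?C ?K' S" using C.Prj_in_Hom[OF Xs', of 0] by simp
  have prj': "Prj ?C ?Xs' (Suc j) \<in> Hom ?C ?K' (fst (Ts ! j))" if "j < ?n" for j
    using C.Prj_in_Hom[OF Xs', of "Suc j"] that by (simp add: nth_append)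
  have prn': "Prj ?C ?Xs' (Suc ?n) \<in> Hom ?C ?K' X"
    using C.Prj_in_Hom[OF Xs', of "Suc ?n"] T by (simp add: nth_append)
  \<comment> \<open>The hypothesis lives over the product of the whole list, the adjunction over the
    binary product of \<open>?K\<close> and \<open>X\<close>. The comparison \<open>e\<close>
    carries the former to the latter.\<close>
  obtain e where e: "e \<in> Hom ?C ?KX ?K'"
    and ej: "\<And>j. j < length ?Xs' \<Longrightarrow>
      Cmp ?C (Prj ?C ?Xs' j) e = (if j < length ?Xs then Cmp ?C (Prj ?C ?Xs j) ?p else ?q)"
  proof (rule C.tuple_exists[OF Xs' KX(1)])
    show "(if j < length ?Xs then Cmp ?C (Prj ?C ?Xs j) ?p else ?q) \<in> Hom ?C ?KX (?Xs' ! j)"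
      if "j < length ?Xs'" for j
    proof (cases "j < length ?Xs")
      case True
      then have "?Xs' ! j = ?Xs ! j" by (simp add: nth_append nth_Cons split: nat.split)
      then show ?thesis using True C.Cmp_in[OF KX(2) C.Prj_in_Hom[OF Xs True]] by simp
    next
      case False
      then have "?Xs' ! j = X" using that T by (auto simp: nth_append nth_Cons split: nat.split)
      then show ?thesis using False KX(3) by simp
    qed
  qed (use that in blast)
  let ?s = "pairing ?C (Prj ?C ?Xs 0)" let ?s' = "pairing ?C (Prj ?C ?Xs' 0)"
  have s: "?s (Prj ?C ?Xs (Suc j)) \<in> Hom ?C ?K (Prd ?C [S, fst (Ts ! j)])" if "j < ?n" for j
    using C.pairing(1)[OF pr0 prj[OF that]] .
  have s': "?s' (Prj ?C ?Xs' (Suc j)) \<in> Hom ?C ?K' (Prd ?C [S, fst (Ts ! j)])" if "j < ?n" for j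
    using C.pairing(1)[OF pr0' prj'[OF that]] .
  have sn': "?s' (Prj ?C ?Xs' (Suc ?n)) \<in> Hom ?C ?K' (Prd ?C [S, X])"
    using C.pairing(1)[OF pr0' prn'] .
  \<comment> \<open>Along \<open>e\<close> the earlier disjuncts become weakenings of formulas over
    \<open>?K\<close>, free of the last variable, while the last one becomes a reindexing along the
    first projection times the identity of \<open>X\<close>, the shape demanded by
    Beck-Chevalley.\<close>
  have e_s: "Cmp ?C (?s' (Prj ?C ?Xs' (Suc j))) e = Cmp ?C (?s (Prj ?C ?Xs (Suc j))) ?p" if "j < ?n" for j
    using C.Cmp_pairing[OF pr0' prj'[OF that] e] C.Cmp_pairing[OF pr0 prj[OF that] KX(2)]
      ej[of 0] ej[of "Suc j"] that by simp
  have e_sn: "Cmp ?C (?s' (Prj ?C ?Xs' (Suc ?n))) e = times_id ?C (Prj ?C ?Xs 0) X"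
    using C.Cmp_pairing[OF pr0' prn' e] ej[of 0] ej[of "Suc ?n"] C.times_id_eq[OF pr0 X] by simp
  have t: "times_id ?C (Prj ?C ?Xs 0) X \<in> Hom ?C ?KX (Prd ?C [S, X])"
    using C.Cmp_in[OF e sn'] e_sn by simp
  define \<theta>' where "\<theta>' = Rdx P (times_id ?C (Prj ?C ?Xs 0) X) \<theta>"
  have \<theta>': "\<theta>' \<in> carrier (Fib P ?KX)" unfolding \<theta>'_def using rdx_closed[OF t \<theta>] .
  define f where "f j = Rdx P (?s (Prj ?C ?Xs (Suc j))) (snd (Ts ! j))" for j
  have f: "f j \<in> carrier (Fib P ?K)" if "j < ?n" for j
    unfolding f_def using rdx_closed[OF s[OF that] Tj(2)[OF that]] .
  have All: "forall_q P S X \<theta> \<in> carrier (Fib P S)" using forall_q(1)[OF S X \<theta>] .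
  interpret FS: boolean_lattice "Fib P S" by (rule fib[OF S])
  interpret FK: boolean_lattice "Fib P ?K" by (rule fib[OF K])
  interpret FKX: boolean_lattice "Fib P ?KX" by (rule fib[OF KX(1)])
  define \<phi>' where "\<phi>' = \<phi> \<sqinter>\<^bsub>Fib P S\<^esub> neg (Fib P S) (forall_q P S X \<theta>)"
  have \<phi>': "\<phi>' \<in> carrier (Fib P S)" unfolding \<phi>'_def using \<phi> FS.neg_complement(1)[OF All] by simp
  have step: "\<exists>j < ?n. f j \<in> U'"
    if U': "ultrafilter (Fib P ?K) U'" "Rdx P (Prj ?C ?Xs 0) \<phi>' \<in> U'" for U'
  proof (rule ccontr)
    assume no: "\<not> (\<exists>j < ?n. f j \<in> U')"
    have "\<phi>' \<in> {\<phi> \<in> carrier (Fib P S). Rdx P (Prj ?C ?Xs 0) \<phi> \<in> U'}" using U' \<phi>' by simp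
    then have U\<phi>: "Rdx P (Prj ?C ?Xs 0) \<phi> \<in> U'" and
      nAll: "Rdx P (Prj ?C ?Xs 0) (forall_q P S X \<theta>) \<notin> U'"
      unfolding \<phi>'_def using FS.ultrafilter_meet_neg_iff[OF rdx_ultrafilter[OF pr0 U'(1)] \<phi> All]
        \<phi> All by simp_all
    let ?F = "f ` {..<?n}"
    have F: "finite ?F" "?F \<subseteq> carrier (Fib P ?K)" using f by auto
    \<comment> \<open>\<open>\<psi>\<close> says over \<open>?K\<close> that \<open>\<phi>\<close>
      holds and all earlier disjuncts fail. It does not involve the last variable, so once its
      weakening is below \<open>\<theta>'\<close>, adjointness puts it below the universal
      quantification of \<open>\<theta>'\<close>.\<close>
    define \<psi> where "\<psi> = Rdx P (Prj ?C ?Xs 0) \<phi> \<sqinter>\<^bsub>Fib P ?K\<^esub> neg (Fib P ?K) (\<Squnion>\<^bsub>Fib P ?K\<^esub> ?F)"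
    note Fs = FK.finite_sup_facts(1)[OF F]
    have p\<phi>: "Rdx P (Prj ?C ?Xs 0) \<phi> \<in> carrier (Fib P ?K)" using rdx_closed[OF pr0 \<phi>] .
    have \<psi>_iff: "\<psi> \<in> V \<longleftrightarrow> Rdx P (Prj ?C ?Xs 0) \<phi> \<in> V \<and> (\<forall>j < ?n. f j \<notin> V)"
      if V: "ultrafilter (Fib P ?K) V" for V
      unfolding \<psi>_def using FK.ultrafilter_meet_neg_iff[OF V p\<phi> Fs]
        FK.ultrafilter_sup_iff[OF V F] by auto
    have \<psi>: "\<psi> \<in> carrier (Fib P ?K)" unfolding \<psi>_def using p\<phi> FK.neg_complement(1)[OF Fs] by simp
    have "Rdx P ?p \<psi> \<sqsubseteq>\<^bsub>Fib P ?KX\<^esub> \<theta>'"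
    proof (subst FKX.le_iff_ultrafilter[OF rdx_closed[OF KX(2) \<psi>] \<theta>'], intro allI impI)
      fix V assume V: "ultrafilter (Fib P ?KX) V" "Rdx P ?p \<psi> \<in> V"
      let ?Vp = "{\<phi> \<in> carrier (Fib P ?K). Rdx P ?p \<phi> \<in> V}"
      let ?Ve = "{\<phi> \<in> carrier (Fib P ?K'). Rdx P e \<phi> \<in> V}"
      have "\<psi> \<in> ?Vp" using V \<psi> by simp
      then have V\<phi>: "Rdx P ?p (Rdx P (Prj ?C ?Xs 0) \<phi>) \<in> V" and Vf: "\<forall>j < ?n. Rdx P ?p (f j) \<notin> V"
        using \<psi>_iff[OF rdx_ultrafilter[OF KX(2) V(1)]] f by auto
      have "Rdx P e (Rdx P (Prj ?C ?Xs' 0) \<phi>) = Rdx P ?p (Rdx P (Prj ?C ?Xs 0) \<phi>)"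
        using rdx_Cmp[OF e pr0' \<phi>] rdx_Cmp[OF KX(2) pr0 \<phi>] ej[of 0] by simp
      then have "Rdx P (Prj ?C ?Xs' 0) \<phi> \<in> ?Ve" using V\<phi> rdx_closed[OF pr0' \<phi>] by simp
      from hyp[OF rdx_ultrafilter[OF e V(1)] this] obtain j where j: "j < Suc ?n"
        "Rdx P e (Rdx P (?s' (Prj ?C ?Xs' (Suc j))) (snd ((Ts @ [T]) ! j))) \<in> V" by auto
      have "j = ?n"
      proof (rule ccontr)
        assume "j \<noteq> ?n"
        then have jn: "j < ?n" using j by simp
        have "Rdx P e (Rdx P (?s' (Prj ?C ?Xs' (Suc j))) (snd (Ts ! j))) = Rdx P ?p (f j)"
          unfolding f_def
          using rdx_Cmp[OF e s'[OF jn] Tj(2)[OF jn]] rdx_Cmp[OF KX(2) s[OF jn] Tj(2)[OF jn]] e_s[OF jn]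
          by simp
        then show False using j Vf jn by (simp add: nth_append)
      qed
      then have "Rdx P e (Rdx P (?s' (Prj ?C ?Xs' (Suc ?n))) \<theta>) \<in> V" using j T by simp
      then show "\<theta>' \<in> V" unfolding \<theta>'_def using rdx_Cmp[OF e sn' \<theta>] e_sn by simp
    qed
    then have "\<psi> \<sqsubseteq>\<^bsub>Fib P ?K\<^esub> forall_q P ?K X \<theta>'" using forall_q(2)[OF K X \<theta>' \<psi>] by simp
    moreover have "\<psi> \<in> U'" using \<psi>_iff[OF U'(1)] U\<phi> no by simp
    ultimately have "forall_q P ?K X \<theta>' \<in> U'"
      using FK.ultrafilter_mono[OF U'(1)] forall_q(1)[OF K X \<theta>'] by simp
    \<comment> \<open>By Beck-Chevalley the quantification of \<open>\<theta>'\<close> over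
      \<open>?K\<close> is the reindexed \<forall>\<theta> from \<open>S\<close>, which
      \<open>\<phi>'\<close> excludes from \<open>U'\<close>.\<close>
    then show False using nAll beck_chevalley[OF S K X pr0 \<theta>] unfolding \<theta>'_def by simp
  qed
  show ?case
  proof (cases "forall_q P S X \<theta> \<in> U")
    case True
    then show ?thesis using T by (intro exI[of _ ?n]) simp
  next
    case False
    then have "\<phi>' \<in> U" unfolding \<phi>'_def
      using FS.ultrafilter_meet_neg_iff[OF snoc.prems(5) \<phi> All] snoc.prems(6) by simp
    have "\<exists>j < ?n. forall_q P S (fst (Ts ! j)) (snd (Ts ! j)) \<in> U"
    proof (rule snoc.IH[OF S _ \<phi>' _ snoc.prems(5) \<open>\<phi>' \<in> U\<close>])
      show "Y \<in> Obj ?C \<and> \<zeta> \<in> carrier (Fib P (Prd ?C [S, Y]))" if "(Y, \<zeta>) \<in> set Ts" for Y \<zeta>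
        using snoc.prems(2)[of Y \<zeta>] that by simp
      show "\<exists>j < ?n. Rdx P (?s (Prj ?C ?Xs (Suc j))) (snd (Ts ! j)) \<in> U'"
        if "ultrafilter (Fib P ?K) U'" "Rdx P (Prj ?C ?Xs 0) \<phi>' \<in> U'" for U'
        using step[OF that] unfolding f_def .
    qed
    then obtain j where "j < ?n" "forall_q P S (fst (Ts ! j)) (snd (Ts ! j)) \<in> U" by blast
    then show ?thesis by (intro exI[of _ j]) (simp add: nth_append)
  qed
qed

end

section \<open>Doctrines of generalised elements\<close>

definition powerset_order :: "'x set \<Rightarrow> ('x set + 'r) gorder" where
  "powerset_order H = \<lparr>carrier = Inl ` Pow H, eq = (=), le = (\<lambda>A B. projl A \<subseteq> projl B)\<rparr>"

lemma powerset_order_simps [simp]: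
  "carrier (powerset_order H) = Inl ` Pow H"
  "A .=\<^bsub>powerset_order H\<^esub> B \<longleftrightarrow> A = B"
  "A \<sqsubseteq>\<^bsub>powerset_order H\<^esub> B \<longleftrightarrow> projl A \<subseteq> projl B"
  by (simp_all add: powerset_order_def)

lemma powerset_partial_order: "partial_order (powerset_order H)"
  by unfold_locales (auto simp: powerset_order_def)

lemma powerset_lub_glb:
  assumes "A \<subseteq> H" "B \<subseteq> H"
  shows "least (powerset_order H) (Inl (A \<union> B)) (Upper (powerset_order H) {Inl A, Inl B})"
    "greatest (powerset_order H) (Inl (A \<inter> B)) (Lower (powerset_order H) {Inl A, Inl B})"
  using assms by (auto simp: least_def greatest_def Upper_def Lower_def)

lemma powerset_bounds:
  "least (powerset_order H) (Inl {}) (carrier (powerset_order H))"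
  "greatest (powerset_order H) (Inl H) (carrier (powerset_order H))"
  unfolding least_def greatest_def by (simp_all add: subset_iff)

lemma powerset_bounded_lattice: "bounded_lattice (powerset_order H)"
proof -
  interpret partial_order "powerset_order H" by (rule powerset_partial_order)
  show ?thesis
  proof unfold_locales
    fix x y :: "'a set + 'b"
    assume "x \<in> carrier (powerset_order H)" "y \<in> carrier (powerset_order H)"
    then obtain A B where "x = Inl A" "y = Inl B" "A \<subseteq> H" "B \<subseteq> H" by auto
    then show "\<exists>s. is_lub (powerset_order H) s {x, y}" "\<exists>s. is_glb (powerset_order H) s {x, y}"
      using powerset_lub_glb by blast+
  qed (use powerset_bounds in blast)+
qed

lemma powerset_operations:
  fixes H :: "'x set"
  defines "L \<equiv> powerset_order H :: ('x set + 'r) gorder"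
  shows "\<lbrakk>A \<subseteq> H; B \<subseteq> H\<rbrakk> \<Longrightarrow> Inl A \<squnion>\<^bsub>L\<^esub> Inl B = Inl (A \<union> B)"
    "\<lbrakk>A \<subseteq> H; B \<subseteq> H\<rbrakk> \<Longrightarrow> Inl A \<sqinter>\<^bsub>L\<^esub> Inl B = Inl (A \<inter> B)"
    "\<bottom>\<^bsub>L\<^esub> = Inl {}" "\<top>\<^bsub>L\<^esub> = Inl H"
proof -
  interpret bounded_lattice L unfolding L_def by (rule powerset_bounded_lattice)
  show "Inl A \<squnion>\<^bsub>L\<^esub> Inl B = Inl (A \<union> B)" if "A \<subseteq> H" "B \<subseteq> H"
  proof -
    have "is_lub L (Inl (A \<union> B)) {Inl A, Inl B}" unfolding L_def by (rule powerset_lub_glb) fact+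
    then show ?thesis
      unfolding join_def using that by (intro least_unique[OF sup_of_two_least]) (auto simp: L_def)
  qed
  show "Inl A \<sqinter>\<^bsub>L\<^esub> Inl B = Inl (A \<inter> B)" if "A \<subseteq> H" "B \<subseteq> H"
  proof -
    have "is_glb L (Inl (A \<inter> B)) {Inl A, Inl B}" unfolding L_def by (rule powerset_lub_glb) fact+
    then show ?thesis
      unfolding meet_def using that by (intro greatest_unique[OF inf_of_two_greatest]) (auto simp: L_def)
  qed
  show "\<bottom>\<^bsub>L\<^esub> = Inl {}"
    by (rule least_unique[OF bottom_least]) (unfold L_def, rule powerset_bounds)
  show "\<top>\<^bsub>L\<^esub> = Inl H"
    by (rule greatest_unique[OF top_greatest]) (unfold L_def, rule powerset_bounds)
qed

lemma powerset_boolean_lattice: "boolean_lattice (powerset_order H)"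
proof -
  interpret bounded_lattice "powerset_order H" by (rule powerset_bounded_lattice)
  show ?thesis
  proof unfold_locales
    fix x y z :: "'a set + 'b"
    assume "x \<in> carrier (powerset_order H)" "y \<in> carrier (powerset_order H)"
      "z \<in> carrier (powerset_order H)"
    then obtain A B D where "x = Inl A" "y = Inl B" "z = Inl D" "A \<subseteq> H" "B \<subseteq> H" "D \<subseteq> H" by auto
    moreover from this have "B \<union> D \<subseteq> H" "A \<inter> B \<subseteq> H" "A \<inter> D \<subseteq> H" by auto
    ultimately show "x \<sqinter>\<^bsub>powerset_order H\<^esub> (y \<squnion>\<^bsub>powerset_order H\<^esub> z) =
        x \<sqinter>\<^bsub>powerset_order H\<^esub> y \<squnion>\<^bsub>powerset_order H\<^esub> x \<sqinter>\<^bsub>powerset_order H\<^esub> z"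
      by (simp add: powerset_operations Int_Un_distrib)
  next
    fix x :: "'a set + 'b"
    assume "x \<in> carrier (powerset_order H)"
    then obtain A where A: "x = Inl A" "A \<subseteq> H" by auto
    then show "\<exists>y\<in>carrier (powerset_order H). x \<sqinter>\<^bsub>powerset_order H\<^esub> y = \<bottom>\<^bsub>powerset_order H\<^esub> \<and>
        x \<squnion>\<^bsub>powerset_order H\<^esub> y = \<top>\<^bsub>powerset_order H\<^esub>"
      by (intro bexI[of _ "Inl (H - A)"]) (auto simp: powerset_operations)
  qed
qed

lemma powerset_neg:
  assumes "A \<subseteq> H"
  shows "neg (powerset_order H) (Inl A) = Inl (H - A)"
  using assms
  by (intro boolean_lattice.neg_equality[OF powerset_boolean_lattice]) (auto simp: powerset_operations)

text \<open>The principal ultrafilter at \<open>s\<close>, that is, truth at one generalised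
  element. Its inverse image under an extended model is the ultrafilter on the completion that
  refutes (1).\<close>

lemma point_ultrafilter:
  assumes "s \<in> H"
  shows "ultrafilter (powerset_order H) (Inl ` {A. A \<subseteq> H \<and> s \<in> A})"
  using assms by (auto simp: ultrafilter_def powerset_operations powerset_neg inj_image_mem_iff)

text \<open>
  The test doctrines have objects in a sum type whose left summand is the type of objects of the
  base; hence the tagged copy of the base and, in the fibres, the tagged copy of the power set.
\<close>

definition copy_category :: "('o, 'a) fpcat \<Rightarrow> ('o + 'd, 'a + 'e) fpcat" where
  "copy_category C =
     \<lparr>Obj = Inl ` Obj C, Arr = Inl ` Arr C,
      Dom = \<lambda>f. Inl (Dom C (projl f)), Cod = \<lambda>f. Inl (Cod C (projl f)),
      Idn = \<lambda>X. Inl (Idn C (projl X)), Cmp = \<lambda>g f. Inl (Cmp C (projl g) (projl f)),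
      Prd = \<lambda>Xs. Inl (Prd C (map projl Xs)), Prj = \<lambda>Xs j. Inl (Prj C (map projl Xs) j)\<rparr>"

lemma copy_category_simps [simp]:
  "Obj (copy_category C) = Inl ` Obj C"
  "Idn (copy_category C) (Inl X) = Inl (Idn C X)"
  "Cmp (copy_category C) (Inl g) (Inl f) = Inl (Cmp C g f)"
  "Prd (copy_category C) (map Inl Xs) = Inl (Prd C Xs)"
  "Prj (copy_category C) (map Inl Xs) j = Inl (Prj C Xs j)"
  "Prd (copy_category C) [Inl X, Inl Y] = Inl (Prd C [X, Y])"
  "Prj (copy_category C) [Inl X, Inl Y] j = Inl (Prj C [X, Y] j)"
  by (simp_all add: copy_category_def comp_def)

lemma copy_category_Hom [simp]: "Inl f \<in> Hom (copy_category C) (Inl X) (Inl Y) \<longleftrightarrow> f \<in> Hom C X Y"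
  by (auto simp: copy_category_def Hom_def)

lemma copy_category_HomE:
  assumes "f \<in> Hom (copy_category C) X Y"
  obtains f' X' Y' where "f = Inl f'" "X = Inl X'" "Y = Inl Y'" "f' \<in> Hom C X' Y'"
  using assms by (auto simp: copy_category_def Hom_def)

text \<open>Stated for an arbitrary product cone because it is used twice: for the chosen products
  of the copy, and for preservation of products by \<open>stage_map\<close>.\<close>

lemma copy_category_product:
  fixes C :: "('o, 'a) fpcat"
  assumes "is_product C Xs K p"
  shows "is_product (copy_category C :: ('o + 'd, 'a + 'e) fpcat) (map Inl Xs) (Inl K) (\<lambda>j. Inl (p j))"
  unfolding is_product_def
proof (intro conjI allI impI ballI)
  let ?D = "copy_category C :: ('o + 'd, 'a + 'e) fpcat"
  show "Inl K \<in> Obj ?D" using assms unfolding is_product_def by simp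
  show "Inl (p j) \<in> Hom ?D (Inl K) (map Inl Xs ! j)" if "j < length (map Inl Xs)" for j
    using assms that unfolding is_product_def by simp
  fix T :: "'o + 'd" and f :: "nat \<Rightarrow> 'a + 'e"
  assume T: "T \<in> Obj ?D"
    and f: "\<forall>j < length (map Inl Xs). f j \<in> Hom ?D T (map Inl Xs ! j)"
  obtain T' where T': "T = Inl T'" "T' \<in> Obj C" using T by auto
  have f': "f j = Inl (projl (f j))" "projl (f j) \<in> Hom C T' (Xs ! j)" if "j < length Xs" for j
  proof -
    have "f j \<in> Hom ?D T (Inl (Xs ! j))" using f that by simp
    then show "f j = Inl (projl (f j))" "projl (f j) \<in> Hom C T' (Xs ! j)"
      by (auto elim!: copy_category_HomE simp: T')
  qed
  have "\<forall>f. (\<forall>j < length Xs. f j \<in> Hom C T' (Xs ! j)) \<longrightarrow>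
      (\<exists>!h. h \<in> Hom C T' K \<and> (\<forall>j < length Xs. Cmp C (p j) h = f j))"
    using assms T'(2) unfolding is_product_def by simp
  from spec[OF this, of "\<lambda>j. projl (f j)"]
  have "\<exists>!h. h \<in> Hom C T' K \<and> (\<forall>j < length Xs. Cmp C (p j) h = projl (f j))"
    using f'(2) by simp
  then obtain h where h: "h \<in> Hom C T' K" "\<forall>j < length Xs. Cmp C (p j) h = projl (f j)"
    and uniq: "\<And>k. \<lbrakk>k \<in> Hom C T' K; \<forall>j < length Xs. Cmp C (p j) k = projl (f j)\<rbrakk> \<Longrightarrow> k = h"
    by blast
  show "\<exists>!h. h \<in> Hom ?D T (Inl K) \<and>
      (\<forall>j < length (map Inl Xs). Cmp ?D (Inl (p j)) h = f j)"
  proof (rule ex1I[of _ "Inl h"])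
    show "Inl h \<in> Hom ?D T (Inl K) \<and>
        (\<forall>j < length (map Inl Xs). Cmp ?D (Inl (p j)) (Inl h) = f j)"
      using h f' T' by simp
    fix k :: "'a + 'e"
    assume k: "k \<in> Hom ?D T (Inl K) \<and>
        (\<forall>j < length (map Inl Xs). Cmp ?D (Inl (p j)) k = f j)"
    then obtain k' where k': "k = Inl k'" "k' \<in> Hom C T' K"
      by (auto elim!: copy_category_HomE simp: T')
    have "Cmp C (p j) k' = projl (f j)" if "j < length Xs" for j
    proof -
      have "Inl (Cmp C (p j) k') = f j" using k k' that by simp
      then show ?thesis by (metis sum.sel(1))
    qed
    then show "k = Inl h" using uniq[OF k'(2)] k'(1) by simp
  qed
qed

lemma copy_fp_category:
  assumes "fp_category C"
  shows "fp_category (copy_category C :: ('o + 'd, 'a + 'e) fpcat)"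
proof -
  interpret fp_category C by fact
  show ?thesis
  proof
    fix f :: "'a + 'e" assume "f \<in> Arr (copy_category C :: ('o + 'd, 'a + 'e) fpcat)"
    then show "Dom (copy_category C) f \<in> Obj (copy_category C :: ('o + 'd, 'a + 'e) fpcat)"
      "Cod (copy_category C) f \<in> Obj (copy_category C :: ('o + 'd, 'a + 'e) fpcat)"
      using Dom_in Cod_in by (auto simp: copy_category_def)
  next
    fix X :: "'o + 'd" assume "X \<in> Obj (copy_category C)"
    then show "Idn (copy_category C) X \<in> Hom (copy_category C) X X" using Idn_in by auto
  next
    fix X Y Z :: "'o + 'd" and f g :: "'a + 'e"
    assume "f \<in> Hom (copy_category C) X Y" "g \<in> Hom (copy_category C) Y Z"
    then show "Cmp (copy_category C) g f \<in> Hom (copy_category C) X Z"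
      by (auto elim!: copy_category_HomE intro: Cmp_in)
  next
    fix X Y :: "'o + 'd" and f :: "'a + 'e"
    assume "f \<in> Hom (copy_category C) X Y"
    then show "Cmp (copy_category C) f (Idn (copy_category C) X) = f"
      "Cmp (copy_category C) (Idn (copy_category C) Y) f = f"
      by (auto elim!: copy_category_HomE intro: Cmp_Idn_right Cmp_Idn_left)
  next
    fix X Y Z W :: "'o + 'd" and f g h :: "'a + 'e"
    assume "f \<in> Hom (copy_category C) X Y" "g \<in> Hom (copy_category C) Y Z"
      "h \<in> Hom (copy_category C) Z W"
    then show "Cmp (copy_category C) h (Cmp (copy_category C) g f) =
        Cmp (copy_category C) (Cmp (copy_category C) h g) f"
      by (auto elim!: copy_category_HomE intro: Cmp_assoc)
  next
    fix Xs :: "('o + 'd) list" assume "set Xs \<subseteq> Obj (copy_category C)"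
    then have Xs: "Xs = map Inl (map projl Xs)" "set (map projl Xs) \<subseteq> Obj C"
      by (auto simp: subset_iff image_iff intro!: map_idI[symmetric])
    let ?D = "copy_category C :: ('o + 'd, 'a + 'e) fpcat" and ?Xs = "map projl Xs"
    have "is_product ?D (map Inl ?Xs) (Prd ?D (map Inl ?Xs)) (Prj ?D (map Inl ?Xs))"
      unfolding copy_category_simps by (rule copy_category_product[OF product[OF Xs(2)]])
    then show "is_product ?D Xs (Prd ?D Xs) (Prj ?D Xs)"
      unfolding Xs(1)[symmetric] .
  qed
qed

lemma copy_category_times_id:
  assumes "fp_category C" "f \<in> Hom C X' X" "Y \<in> Obj C"
  shows "times_id (copy_category C :: ('o + 'd, 'a + 'e) fpcat) (Inl f) (Inl Y) = Inl (times_id C f Y)"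
proof -
  interpret fp_category C by fact
  interpret D: fp_category "copy_category C :: ('o + 'd, 'a + 'e) fpcat" by (rule copy_fp_category) fact
  let ?D = "copy_category C :: ('o + 'd, 'a + 'e) fpcat"
  have X': "X' \<in> Obj C" and X: "X \<in> Obj C" using Hom_Obj[OF assms(2)] by auto
  have u: "Cmp C f (Prj C [X', Y] 0) \<in> Hom C (Prd C [X', Y]) X"
    and v: "Prj C [X', Y] (Suc 0) \<in> Hom C (Prd C [X', Y]) Y"
    using Cmp_in[OF Prj_pair(2)[OF X' assms(3)] assms(2)] Prj_pair(3)[OF X' assms(3)] by auto
  have "times_id ?D (Inl f) (Inl Y) =
      pairing ?D (Inl (Cmp C f (Prj C [X', Y] 0))) (Inl (Prj C [X', Y] (Suc 0)))"
    using D.times_id_eq[of "Inl f" "Inl X'" "Inl X" "Inl Y"] assms by simp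
  also have "\<dots> = Inl (pairing C (Cmp C f (Prj C [X', Y] 0)) (Prj C [X', Y] (Suc 0)))"
    by (rule D.pairing_unique[symmetric, of _ "Inl (Prd C [X', Y])" "Inl X" "Inl Y"])
      (use X assms(3) pairing[OF u v] in simp_all)
  finally show ?thesis using times_id_eq[OF assms(2,3)] by simp
qed

text \<open>
  The doctrine of subsets of generalised elements of stage \<open>K\<close>: the power set doctrine of sets,
  restricted along the representable functor of \<open>K\<close>.
\<close>

definition stage_doctrine :: "('o, 'a) fpcat \<Rightarrow> 'o \<Rightarrow> ('o + 'd, 'a + 'e, 'a set + 'r) doctrine" where
  "stage_doctrine C K =
     \<lparr>Base = copy_category C, Fib = \<lambda>X. powerset_order (Hom C K (projl X)),
      Rdx = \<lambda>f A. Inl {h \<in> Hom C K (Dom C (projl f)). Cmp C (projl f) h \<in> projl A}\<rparr>"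

lemma stage_doctrine_simps [simp]:
  "Base (stage_doctrine C K) = copy_category C"
  "Fib (stage_doctrine C K) (Inl X) = powerset_order (Hom C K X)"
  "f \<in> Hom C X Y \<Longrightarrow> Rdx (stage_doctrine C K) (Inl f) (Inl A) = Inl {h \<in> Hom C K X. Cmp C f h \<in> A}"
  by (simp_all add: stage_doctrine_def Hom_def)

lemma stage_boolean_doctrine:
  assumes "fp_category C"
  shows "boolean_doctrine (stage_doctrine C K :: ('o + 'd, 'a + 'e, 'a set + 'r) doctrine)"
    (is "boolean_doctrine ?R")
proof -
  interpret fp_category C by fact
  show ?thesis
  proof (rule boolean_doctrine.intro)
    show "fp_category (Base ?R)" using copy_fp_category[OF assms] by simp
  next
    fix X :: "'o + 'd" assume "X \<in> Obj (Base ?R)"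
    show "boolean_lattice (Fib ?R X)" unfolding stage_doctrine_def using powerset_boolean_lattice by simp
  next
    fix X Y :: "'o + 'd" and f :: "'a + 'e" assume "f \<in> Hom (Base ?R) X Y"
    then obtain f' X' Y' where f: "f = Inl f'" "X = Inl X'" "Y = Inl Y'" "f' \<in> Hom C X' Y'"
      by (auto elim!: copy_category_HomE)
    have cmp: "Cmp C f' h \<in> Hom C K Y'" if "h \<in> Hom C K X'" for h
      using Cmp_in[OF that f(4)] .
    show "boolean_hom (Fib ?R Y) (Fib ?R X) (Rdx ?R f)"
      unfolding boolean_hom_def f(1-3) stage_doctrine_simps(2)
    proof (intro conjI ballI)
      show "Rdx ?R (Inl f') \<in> carrier (powerset_order (Hom C K Y')) \<rightarrow> carrier (powerset_order (Hom C K X'))"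
        using f(4) by auto
      show "Rdx ?R (Inl f') \<bottom>\<^bsub>powerset_order (Hom C K Y')\<^esub> = \<bottom>\<^bsub>powerset_order (Hom C K X')\<^esub>"
        "Rdx ?R (Inl f') \<top>\<^bsub>powerset_order (Hom C K Y')\<^esub> = \<top>\<^bsub>powerset_order (Hom C K X')\<^esub>"
        using f(4) cmp by (auto simp: powerset_operations)
      fix x :: "'a set + 'r" assume "x \<in> carrier (powerset_order (Hom C K Y'))"
      then obtain A where A: "x = Inl A" "A \<subseteq> Hom C K Y'" by auto
      have pA: "{h \<in> Hom C K X'. Cmp C f' h \<in> A} \<subseteq> Hom C K X'" by auto
      show "Rdx ?R (Inl f') (neg (powerset_order (Hom C K Y')) x) =
          neg (powerset_order (Hom C K X')) (Rdx ?R (Inl f') x)"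
        using f(4) A cmp powerset_neg[OF pA] by (auto simp: powerset_neg)
      fix y :: "'a set + 'r" assume "y \<in> carrier (powerset_order (Hom C K Y'))"
      then obtain B where B: "y = Inl B" "B \<subseteq> Hom C K Y'" by auto
      have pB: "{h \<in> Hom C K X'. Cmp C f' h \<in> B} \<subseteq> Hom C K X'" by auto
      show "Rdx ?R (Inl f') (x \<sqinter>\<^bsub>powerset_order (Hom C K Y')\<^esub> y) =
          Rdx ?R (Inl f') x \<sqinter>\<^bsub>powerset_order (Hom C K X')\<^esub> Rdx ?R (Inl f') y"
        using f(4) A B powerset_operations(2)[OF pA pB] by (auto simp: powerset_operations)
      show "Rdx ?R (Inl f') (x \<squnion>\<^bsub>powerset_order (Hom C K Y')\<^esub> y) =
          Rdx ?R (Inl f') x \<squnion>\<^bsub>powerset_order (Hom C K X')\<^esub> Rdx ?R (Inl f') y"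
        using f(4) A B powerset_operations(1)[OF pA pB] by (auto simp: powerset_operations)
    qed
  next
    fix X :: "'o + 'd" and \<phi> :: "'a set + 'r"
    assume "X \<in> Obj (Base ?R)" "\<phi> \<in> carrier (Fib ?R X)"
    then obtain X' A where X: "X = Inl X'" "X' \<in> Obj C" "\<phi> = Inl A" "A \<subseteq> Hom C K X'" by auto
    then show "Rdx ?R (Idn (Base ?R) X) \<phi> = \<phi>"
      using Idn_in[OF X(2)] Cmp_Idn_left by auto
  next
    fix X Y Z :: "'o + 'd" and f g :: "'a + 'e" and \<phi> :: "'a set + 'r"
    assume f: "f \<in> Hom (Base ?R) X Y" and g: "g \<in> Hom (Base ?R) Y Z" and \<phi>: "\<phi> \<in> carrier (Fib ?R Z)"
    obtain f' X' Y' where f': "f = Inl f'" "X = Inl X'" "Y = Inl Y'" "f' \<in> Hom C X' Y'"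
      using f by (auto elim!: copy_category_HomE)
    obtain g' Z' where g': "g = Inl g'" "Z = Inl Z'" "g' \<in> Hom C Y' Z'"
      using g f'(3) by (auto elim!: copy_category_HomE)
    obtain A where A: "\<phi> = Inl A" "A \<subseteq> Hom C K Z'" using \<phi> g'(2) by auto
    show "Rdx ?R (Cmp (Base ?R) g f) \<phi> = Rdx ?R f (Rdx ?R g \<phi>)"
      using f' g' A Cmp_in[OF f'(4) g'(3)] Cmp_in[OF _ f'(4), of _ K] Cmp_assoc[OF _ f'(4) g'(3)] by auto
  qed
qed

text \<open>Reindexing is inverse image under composition with \<open>p\<close>, and its right
  adjoint is the universal image: the points whose whole fibre lies in the given set.\<close>

lemma stage_lower_adjoint:
  assumes "fp_category C" "p \<in> Hom C T X"
  shows "lower_adjoint (powerset_order (Hom C K X)) (powerset_order (Hom C K T))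
      (Rdx (stage_doctrine C K :: ('o + 'd, 'a + 'e, 'a set + 'r) doctrine) (Inl p))"
  unfolding lower_adjoint_def
proof (intro exI)
  interpret fp_category C by fact
  show "galois_connection \<lparr>orderA = powerset_order (Hom C K X), orderB = powerset_order (Hom C K T),
      lower = Rdx (stage_doctrine C K :: ('o + 'd, 'a + 'e, 'a set + 'r) doctrine) (Inl p),
      upper = \<lambda>A. Inl {s \<in> Hom C K X. \<forall>h \<in> Hom C K T. Cmp C p h = s \<longrightarrow> h \<in> projl A}\<rparr>"
  proof (intro galois_connection.intro connection.intro galois_connection_axioms.intro;
      unfold galcon.simps)
    fix x y :: "'a set + 'r"
    assume "x \<in> carrier (powerset_order (Hom C K X))" "y \<in> carrier (powerset_order (Hom C K T))"
    then obtain A B where "x = Inl A" "y = Inl B" "A \<subseteq> Hom C K X" "B \<subseteq> Hom C K T" by auto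
    then show "Rdx (stage_doctrine C K :: ('o + 'd, 'a + 'e, 'a set + 'r) doctrine) (Inl p) x
          \<sqsubseteq>\<^bsub>powerset_order (Hom C K T)\<^esub> y \<longleftrightarrow>
        x \<sqsubseteq>\<^bsub>powerset_order (Hom C K X)\<^esub>
          Inl {s \<in> Hom C K X. \<forall>h \<in> Hom C K T. Cmp C p h = s \<longrightarrow> h \<in> projl y}"
      using assms(2) by auto
  qed (use assms(2) powerset_partial_order in auto)
qed

text \<open>The chosen adjoint is pinned down by testing the adjunction on singletons:
  \<open>{s}\<close> is below the value at \<open>A\<close> exactly if the fibre over
  \<open>s\<close> is contained in \<open>A\<close>.\<close>

lemma stage_forall_along:
  assumes C: "fp_category C" and p: "p \<in> Hom C T X" and A: "A \<subseteq> Hom C K T"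
  shows "forall_along (stage_doctrine C K :: ('o + 'd, 'a + 'e, 'a set + 'r) doctrine) (Inl p) (Inl A) =
    Inl {s \<in> Hom C K X. \<forall>h \<in> Hom C K T. Cmp C p h = s \<longrightarrow> h \<in> A}"
proof -
  let ?R = "stage_doctrine C K :: ('o + 'd, 'a + 'e, 'a set + 'r) doctrine"
  note adj = lower_adjoint_forall_along[of ?R "Inl X" "Inl T" "Inl p" "Inl A", simplified,
      OF stage_lower_adjoint[OF C p] p]
  obtain B where B: "forall_along ?R (Inl p) (Inl A) = Inl B" "B \<subseteq> Hom C K X"
    using adj(1) A by auto
  have "s \<in> B \<longleftrightarrow> (\<forall>h \<in> Hom C K T. Cmp C p h = s \<longrightarrow> h \<in> A)" if s: "s \<in> Hom C K X" for s
    using adj(2)[of "Inl {s}"] A s p B by auto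
  then show ?thesis using B by auto
qed

lemma stage_fo_boolean_doctrine:
  assumes "fp_category C"
  shows "fo_boolean_doctrine (stage_doctrine C K :: ('o + 'd, 'a + 'e, 'a set + 'r) doctrine)"
    (is "fo_boolean_doctrine ?R")
proof -
  interpret fp_category C by fact
  show ?thesis
  proof (intro fo_boolean_doctrine.intro fo_boolean_doctrine_axioms.intro)
    show "boolean_doctrine ?R" by (rule stage_boolean_doctrine) fact
  next
    fix X Y :: "'o + 'd" assume "X \<in> Obj (Base ?R)" "Y \<in> Obj (Base ?R)"
    then obtain X0 Y0 where X0: "X = Inl X0" "X0 \<in> Obj C" and Y0: "Y = Inl Y0" "Y0 \<in> Obj C" by auto
    show "lower_adjoint (Fib ?R X) (Fib ?R (Prd (Base ?R) [X, Y])) (Rdx ?R (Prj (Base ?R) [X, Y] 0))"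
      unfolding X0(1) Y0(1) stage_doctrine_simps(1,2) copy_category_simps
      by (rule stage_lower_adjoint[OF assms Prj_pair(2)[OF X0(2) Y0(2)]])
  next
    fix X X' Y :: "'o + 'd" and f :: "'a + 'e" and \<phi> :: "'a set + 'r"
    assume f: "f \<in> Hom (Base ?R) X' X" and Y: "Y \<in> Obj (Base ?R)"
      and \<phi>: "\<phi> \<in> carrier (Fib ?R (Prd (Base ?R) [X, Y]))"
    obtain f0 X0 X0' where f0: "f = Inl f0" "X = Inl X0" "X' = Inl X0'" "f0 \<in> Hom C X0' X0"
      using f by (auto elim!: copy_category_HomE)
    obtain Y0 where Y0: "Y = Inl Y0" "Y0 \<in> Obj C" using Y by auto
    obtain A where A: "\<phi> = Inl A" "A \<subseteq> Hom C K (Prd C [X0, Y0])" using \<phi> f0 Y0 by auto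
    have X0: "X0 \<in> Obj C" and X0': "X0' \<in> Obj C" using Hom_Obj[OF f0(4)] by auto
    note p = Prj_pair[OF X0 Y0(2)] and p' = Prj_pair[OF X0' Y0(2)]
    let ?t = "times_id C f0 Y0"
    have u: "Cmp C f0 (Prj C [X0', Y0] 0) \<in> Hom C (Prd C [X0', Y0]) X0" using Cmp_in[OF p'(2) f0(4)] .
    have t_eq: "?t = pairing C (Cmp C f0 (Prj C [X0', Y0] 0)) (Prj C [X0', Y0] (Suc 0))"
      using times_id_eq[OF f0(4) Y0(2)] .
    have t: "?t \<in> Hom C (Prd C [X0', Y0]) (Prd C [X0, Y0])"
      unfolding t_eq using pairing(1)[OF u p'(3)] .
    have "(\<forall>h \<in> Hom C K (Prd C [X0, Y0]). Cmp C (Prj C [X0, Y0] 0) h = Cmp C f0 k \<longrightarrow> h \<in> A) \<longleftrightarrow>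
        (\<forall>h \<in> Hom C K (Prd C [X0', Y0]). Cmp C (Prj C [X0', Y0] 0) h = k \<longrightarrow> Cmp C ?t h \<in> A)"
      (is "?l \<longleftrightarrow> ?r") if k: "k \<in> Hom C K X0'" for k
    proof
      assume l: ?l
      show ?r
      proof (intro ballI impI)
        fix h assume h: "h \<in> Hom C K (Prd C [X0', Y0])" "Cmp C (Prj C [X0', Y0] 0) h = k"
        have "Cmp C (Prj C [X0, Y0] 0) (Cmp C ?t h) = Cmp C (Cmp C f0 (Prj C [X0', Y0] 0)) h"
          using Cmp_assoc[OF h(1) t p(2)] pairing(2)[OF u p'(3)] t_eq by simp
        also have "\<dots> = Cmp C f0 k" using Cmp_assoc[OF h(1) p'(2) f0(4)] h(2) by simp
        finally show "Cmp C ?t h \<in> A" using l Cmp_in[OF h(1) t] by blast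
      qed
    next
      assume r: ?r
      show ?l
      proof (intro ballI impI)
        fix h assume h: "h \<in> Hom C K (Prd C [X0, Y0])" "Cmp C (Prj C [X0, Y0] 0) h = Cmp C f0 k"
        \<comment> \<open>An element \<open>h\<close> over the image of \<open>k\<close> is the
          image of the pair of \<open>k\<close> and the second component \<open>?y\<close> of
          \<open>h\<close>, so the assumption on the fibre over \<open>k\<close> reaches it.\<close>
        let ?y = "Cmp C (Prj C [X0, Y0] (Suc 0)) h"
        have y: "?y \<in> Hom C K Y0" using Cmp_in[OF h(1) p(3)] .
        note ky = pairing[OF k y]
        have "Cmp C ?t (pairing C k ?y) = pairing C (Cmp C f0 k) ?y"
          unfolding t_eq using Cmp_pairing[OF u p'(3) ky(1)] ky Cmp_assoc[OF ky(1) p'(2) f0(4)] by simp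
        also have "\<dots> = h" using pairing_unique[OF h(1) X0 Y0(2) h(2) refl] by simp
        finally show "h \<in> A" using r ky by auto
      qed
    qed
    then have E1: "{k \<in> Hom C K X0'. \<forall>h \<in> Hom C K (Prd C [X0, Y0]). Cmp C (Prj C [X0, Y0] 0) h = Cmp C f0 k \<longrightarrow> h \<in> A} =
      {k \<in> Hom C K X0'. \<forall>h \<in> Hom C K (Prd C [X0', Y0]). Cmp C (Prj C [X0', Y0] 0) h = k \<longrightarrow>
         h \<in> {h \<in> Hom C K (Prd C [X0', Y0]). Cmp C ?t h \<in> A}}" by auto
    have E2: "forall_q ?R X Y \<phi> = Inl {s \<in> Hom C K X0. \<forall>h \<in> Hom C K (Prd C [X0, Y0]).
        Cmp C (Prj C [X0, Y0] 0) h = s \<longrightarrow> h \<in> A}"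
      unfolding forall_q_def f0 Y0 A stage_doctrine_simps(1) copy_category_simps
      by (rule stage_forall_along[OF assms p(2) A(2)])
    have E3: "forall_q ?R X' Y (Inl {h \<in> Hom C K (Prd C [X0', Y0]). Cmp C ?t h \<in> A}) =
        Inl {k \<in> Hom C K X0'. \<forall>h \<in> Hom C K (Prd C [X0', Y0]). Cmp C (Prj C [X0', Y0] 0) h = k \<longrightarrow>
         h \<in> {h \<in> Hom C K (Prd C [X0', Y0]). Cmp C ?t h \<in> A}}"
      unfolding forall_q_def f0 Y0 stage_doctrine_simps(1) copy_category_simps
      by (rule stage_forall_along[OF assms p'(2)]) auto
    have E4: "Rdx ?R (times_id (Base ?R) f Y) \<phi> =
        Inl {h \<in> Hom C K (Prd C [X0', Y0]). Cmp C ?t h \<in> A}"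
      unfolding f0 Y0 A stage_doctrine_simps(1) copy_category_times_id[OF assms f0(4) Y0(2)]
      by (rule stage_doctrine_simps(3)[OF t])
    have E5: "{k \<in> Hom C K X0'. Cmp C f0 k \<in> {s \<in> Hom C K X0. Q s}} = {k \<in> Hom C K X0'. Q (Cmp C f0 k)}"
      for Q using Cmp_in[OF _ f0(4), of _ K] by blast
    show "Rdx ?R f (forall_q ?R X Y \<phi>) = forall_q ?R X' Y (Rdx ?R (times_id (Base ?R) f Y) \<phi>)"
      unfolding E4 E3 E2 unfolding f0(1) stage_doctrine_simps(3)[OF f0(4)] E5 E1 ..
  qed
qed

section \<open>The model of a doctrine determined by an ultrafilter\<close>

definition stage_map :: "('o, 'a, 'b) doctrine \<Rightarrow> 'o \<Rightarrow> 'b set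
    \<Rightarrow> ('o, 'a, 'b, 'o + 'd, 'a + 'e, 'a set + 'r) doctrine_map" where
  "stage_map P K U = \<lparr>On_Obj = Inl, On_Arr = Inl,
     On_Fib = \<lambda>X \<phi>. Inl {h \<in> Hom (Base P) K X. Rdx P h \<phi> \<in> U}\<rparr>"

text \<open>Each \<open>h\<close> pulls \<open>U\<close> back to an ultrafilter over
  \<open>X\<close>, so the Boolean operations are computed pointwise in \<open>h\<close>. Naturality
  is functoriality of reindexing.\<close>

lemma stage_map_morphism:
  assumes "boolean_doctrine P" and U: "ultrafilter (Fib P K) U"
  shows "boolean_doctrine_morphism P
    (stage_doctrine (Base P) K :: ('o + 'd, 'a + 'e, 'a set + 'r) doctrine) (stage_map P K U)"
proof -
  interpret boolean_doctrine P by fact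
  interpret fp_category "Base P" by (rule base)
  show ?thesis
  proof (rule boolean_doctrine_morphism.intro; unfold stage_map_def doctrine_map.simps stage_doctrine_simps(1,2))
    fix X assume X: "X \<in> Obj (Base P)"
    interpret F: boolean_lattice "Fib P X" by (rule fib[OF X])
    let ?H = "Hom (Base P) K X"
    let ?m = "\<lambda>\<phi>. Inl {h \<in> ?H. Rdx P h \<phi> \<in> U} :: 'a set + 'r"
    have sub: "{h \<in> ?H. Rdx P h \<phi> \<in> U} \<subseteq> ?H" for \<phi> by auto
    have V: "ultrafilter (Fib P X) {\<phi> \<in> carrier (Fib P X). Rdx P h \<phi> \<in> U}" if "h \<in> ?H" for h
      using rdx_ultrafilter[OF that U] .
    show "boolean_hom (Fib P X) (powerset_order ?H) ?m"
      unfolding boolean_hom_def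
    proof (intro conjI ballI)
      show "?m \<in> carrier (Fib P X) \<rightarrow> carrier (powerset_order ?H)" by auto
      show "?m \<bottom>\<^bsub>Fib P X\<^esub> = \<bottom>\<^bsub>powerset_order ?H\<^esub>" "?m \<top>\<^bsub>Fib P X\<^esub> = \<top>\<^bsub>powerset_order ?H\<^esub>"
        using ultrafilter_simps(2,3)[OF V] F.bottom_closed F.top_closed by (auto simp: powerset_operations)
      fix x assume x: "x \<in> carrier (Fib P X)"
      show "?m (neg (Fib P X) x) = neg (powerset_order ?H) (?m x)"
        unfolding powerset_neg[OF sub]
        using ultrafilter_simps(6)[OF V x] x F.neg_complement(1)[OF x] by auto
      fix y assume y: "y \<in> carrier (Fib P X)"
      show "?m (x \<sqinter>\<^bsub>Fib P X\<^esub> y) = ?m x \<sqinter>\<^bsub>powerset_order ?H\<^esub> ?m y"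
        unfolding powerset_operations(2)[OF sub sub]
        using ultrafilter_simps(4)[OF V x y] x y F.meet_closed[OF x y] by auto
      show "?m (x \<squnion>\<^bsub>Fib P X\<^esub> y) = ?m x \<squnion>\<^bsub>powerset_order ?H\<^esub> ?m y"
        unfolding powerset_operations(1)[OF sub sub]
        using ultrafilter_simps(5)[OF V x y] x y F.join_closed[OF x y] by auto
    qed
  next
    fix f X Y \<phi> assume f: "f \<in> Hom (Base P) X Y" and \<phi>: "\<phi> \<in> carrier (Fib P Y)"
    show "Inl {h \<in> Hom (Base P) K X. Rdx P h (Rdx P f \<phi>) \<in> U} =
       Rdx (stage_doctrine (Base P) K :: ('o + 'd, 'a + 'e, 'a set + 'r) doctrine) (Inl f)
         (Inl {h \<in> Hom (Base P) K Y. Rdx P h \<phi> \<in> U})"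
      using f Cmp_in[OF _ f, of _ K] rdx_Cmp[OF _ f \<phi>] by auto
  next
    fix Xs assume "set Xs \<subseteq> Obj (Base P)"
    then show "is_product (copy_category (Base P)) (map Inl Xs) (Inl (Prd (Base P) Xs))
        (\<lambda>j. Inl (Prj (Base P) Xs j))"
      by (intro copy_category_product product)
  qed auto
qed

section \<open>Quantifier completions\<close>

lemma quantifier_completionD:
  assumes "quantifier_completion TYPE(('d, 'e, 'r) doctrine) P Q i"
  shows "Base Q = Base P" "fo_boolean_doctrine Q"
    "X \<in> Obj (Base P) \<Longrightarrow> boolean_hom (Fib P X) (Fib Q X) (i X)"
    "\<lbrakk>X \<in> Obj (Base P); \<phi> \<in> carrier (Fib P X)\<rbrakk> \<Longrightarrow> i X \<phi> \<in> carrier (Fib Q X)"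
    "\<lbrakk>X \<in> Obj (Base P); \<phi> \<in> carrier (Fib P X)\<rbrakk> \<Longrightarrow> i X (neg (Fib P X) \<phi>) = neg (Fib Q X) (i X \<phi>)"
    "\<lbrakk>f \<in> Hom (Base P) X Y; \<phi> \<in> carrier (Fib P Y)\<rbrakk> \<Longrightarrow> i X (Rdx P f \<phi>) = Rdx Q f (i Y \<phi>)"
proof -
  have m: "boolean_doctrine_morphism P Q (over_identity i)"
    and *: "Base Q = Base P" "fo_boolean_doctrine Q"
    using assms unfolding quantifier_completion_def by auto
  show "Base Q = Base P" "fo_boolean_doctrine Q" by fact+
  show h: "boolean_hom (Fib P X) (Fib Q X) (i X)" if "X \<in> Obj (Base P)" for X
    using boolean_doctrine_morphism.on_Fib[OF m that] by (simp add: over_identity_def)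
  show "i X \<phi> \<in> carrier (Fib Q X)" "i X (neg (Fib P X) \<phi>) = neg (Fib Q X) (i X \<phi>)"
    if "X \<in> Obj (Base P)" "\<phi> \<in> carrier (Fib P X)"
    using h[OF that(1)] that(2) unfolding boolean_hom_def by auto
  show "i X (Rdx P f \<phi>) = Rdx Q f (i Y \<phi>)" if "f \<in> Hom (Base P) X Y" "\<phi> \<in> carrier (Fib P Y)"
    using boolean_doctrine_morphism.natural[OF m that] by (simp add: over_identity_def)
qed

text \<open>
  The ultrafilter \<open>U\<close> makes the representable functor of \<open>K\<close> a model of \<open>P\<close>; in the extension of
  this model to \<open>Q\<close>, quantifiers at the element \<open>s\<close> of \<open>S\<close> range over the morphisms out of \<open>K\<close>.
\<close>

lemma completion_stage_model:
  fixes P :: "('o, 'a, 'b) doctrine" and Q :: "('o, 'a, 'q) doctrine"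
  assumes P: "boolean_doctrine P"
    and Q: "quantifier_completion TYPE(('o + 'd, 'a + 'e, 'a set + 'r) doctrine) P Q i"
    and U: "ultrafilter (Fib P K) U" and s: "s \<in> Hom (Base P) K S"
  obtains V where "ultrafilter (Fib Q S) V"
    "\<And>X \<psi>. \<lbrakk>X \<in> Obj (Base P); \<psi> \<in> carrier (Fib P (Prd (Base P) [S, X]))\<rbrakk> \<Longrightarrow>
       forall_q Q S X (i (Prd (Base P) [S, X]) \<psi>) \<in> V \<longleftrightarrow>
       (\<forall>g \<in> Hom (Base P) K X. Rdx P (pairing (Base P) s g) \<psi> \<in> U)"
    "\<And>X \<psi>. \<lbrakk>X \<in> Obj (Base P); \<psi> \<in> carrier (Fib P (Prd (Base P) [S, X]))\<rbrakk> \<Longrightarrow>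
       exists_q Q S X (i (Prd (Base P) [S, X]) \<psi>) \<in> V \<longleftrightarrow>
       (\<exists>g \<in> Hom (Base P) K X. Rdx P (pairing (Base P) s g) \<psi> \<in> U)"
proof -
  interpret P: boolean_doctrine P by fact
  interpret C: fp_category "Base P" by (rule P.base)
  note QD = quantifier_completionD[OF Q]
  interpret Q: fo_boolean_doctrine Q by (rule QD)
  let ?C = "Base P"
  let ?R = "stage_doctrine ?C K :: ('o + 'd, 'a + 'e, 'a set + 'r) doctrine"
  let ?M = "stage_map P K U :: ('o, 'a, 'b, 'o + 'd, 'a + 'e, 'a set + 'r) doctrine_map"
  have "fo_boolean_doctrine ?R" "boolean_doctrine_morphism P ?R ?M"
    using stage_fo_boolean_doctrine[OF C.fp_category_axioms] stage_map_morphism[OF P U] by auto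
  then obtain N where N: "fo_boolean_doctrine_morphism Q ?R N"
    and same: "same_morphism P (compose_map N (over_identity i)) ?M"
    using Q unfolding quantifier_completion_def by blast
  interpret N: fo_boolean_doctrine_morphism Q ?R N by (rule N)
  \<comment> \<open>The unit lies over the identity functor, so agreement with \<open>?M\<close>
    determines \<open>N\<close> on all objects and arrows, and on the fibres at the images of
    \<open>i\<close>.\<close>
  have N_Obj: "On_Obj N X = Inl X" if "X \<in> Obj ?C" for X
    using same that unfolding same_morphism_def
    by (simp add: compose_map_def over_identity_def stage_map_def)
  have N_Arr: "On_Arr N f = Inl f" if "f \<in> Hom ?C X Y" for f X Y
    using same that unfolding same_morphism_def Hom_def
    by (simp add: compose_map_def over_identity_def stage_map_def)
  have N_Fib: "On_Fib N X (i X \<phi>) = Inl {h \<in> Hom ?C K X. Rdx P h \<phi> \<in> U}"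
    if "X \<in> Obj ?C" "\<phi> \<in> carrier (Fib P X)" for X \<phi>
    using same that unfolding same_morphism_def
    by (simp add: compose_map_def over_identity_def stage_map_def)
  have S: "S \<in> Obj ?C" using C.Hom_Obj[OF s] by simp
  \<comment> \<open>\<open>V\<close> collects the elements of the completion over \<open>S\<close>
    whose interpretation in the model contains the point \<open>s\<close>.\<close>
  define V where "V = {x \<in> carrier (Fib Q S).
      On_Fib N S x \<in> Inl ` {A. A \<subseteq> Hom ?C K S \<and> s \<in> A}}"
  have hom: "boolean_hom (Fib Q S) (powerset_order (Hom ?C K S)) (On_Fib N S)"
    using N.on_Fib[of S] QD(1) S N_Obj[OF S] by simp
  have "boolean_lattice (Fib Q S)" using Q.fib[of S] QD(1) S by simp
  then have V: "ultrafilter (Fib Q S) V"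
    unfolding V_def by (rule boolean_hom_ultrafilter[OF hom _ point_ultrafilter[OF s]])
  have All: "forall_q Q S X (i (Prd ?C [S, X]) \<psi>) \<in> V \<longleftrightarrow>
      (\<forall>g \<in> Hom ?C K X. Rdx P (pairing ?C s g) \<psi> \<in> U)"
    if X: "X \<in> Obj ?C" and \<psi>: "\<psi> \<in> carrier (Fib P (Prd ?C [S, X]))" for X \<psi>
  proof -
    note p = C.Prj_pair[OF S X]
    let ?A = "{h \<in> Hom ?C K (Prd ?C [S, X]). Rdx P h \<psi> \<in> U}"
    have i: "i (Prd ?C [S, X]) \<psi> \<in> carrier (Fib Q (Prd ?C [S, X]))" using QD(4)[OF p(1) \<psi>] .
    have c: "forall_q Q S X (i (Prd ?C [S, X]) \<psi>) \<in> carrier (Fib Q S)"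
      using Q.forall_q(1)[of S X] QD(1) S X i by simp
    have "On_Fib N S (forall_q Q S X (i (Prd ?C [S, X]) \<psi>)) =
        forall_along ?R (On_Arr N (Prj ?C [S, X] 0)) (On_Fib N (Prd ?C [S, X]) (i (Prd ?C [S, X]) \<psi>))"
      using N.on_All[of S X] QD(1) S X i by simp
    also have "\<dots> = forall_along ?R (Inl (Prj ?C [S, X] 0)) (Inl ?A)"
      using N_Arr[OF p(2)] N_Fib[OF p(1) \<psi>] by simp
    also have "\<dots> = Inl {s \<in> Hom ?C K S. \<forall>h \<in> Hom ?C K (Prd ?C [S, X]).
        Cmp ?C (Prj ?C [S, X] 0) h = s \<longrightarrow> h \<in> ?A}"
      by (rule stage_forall_along[OF C.fp_category_axioms p(2)]) auto
    finally have "forall_q Q S X (i (Prd ?C [S, X]) \<psi>) \<in> V \<longleftrightarrow>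
        (\<forall>h \<in> Hom ?C K (Prd ?C [S, X]). Cmp ?C (Prj ?C [S, X] 0) h = s \<longrightarrow> Rdx P h \<psi> \<in> U)"
      unfolding V_def using c s by (auto simp: inj_image_mem_iff)
    \<comment> \<open>Elements of the product of \<open>S\<close> and \<open>X\<close> with first
      component \<open>s\<close> are exactly the pairings of \<open>s\<close> with some
      \<open>g\<close>, so quantifying over the fibre is quantifying over arrows out of
      \<open>K\<close>.\<close>
    also have "\<dots> \<longleftrightarrow> (\<forall>g \<in> Hom ?C K X. Rdx P (pairing ?C s g) \<psi> \<in> U)"
    proof (intro iffI ballI impI)
      fix g assume *: "\<forall>h \<in> Hom ?C K (Prd ?C [S, X]). Cmp ?C (Prj ?C [S, X] 0) h = s \<longrightarrow> Rdx P h \<psi> \<in> U"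
        and g: "g \<in> Hom ?C K X"
      show "Rdx P (pairing ?C s g) \<psi> \<in> U" using * C.pairing[OF s g] by simp
    next
      fix h assume *: "\<forall>g \<in> Hom ?C K X. Rdx P (pairing ?C s g) \<psi> \<in> U"
        and h: "h \<in> Hom ?C K (Prd ?C [S, X])" "Cmp ?C (Prj ?C [S, X] 0) h = s"
      show "Rdx P h \<psi> \<in> U"
        using * C.Cmp_in[OF h(1) p(3)] C.pairing_unique[OF h(1) S X h(2) refl] by metis
    qed
    finally show ?thesis .
  qed
  have "exists_q Q S X (i (Prd ?C [S, X]) \<psi>) \<in> V \<longleftrightarrow>
      (\<exists>g \<in> Hom ?C K X. Rdx P (pairing ?C s g) \<psi> \<in> U)"
    if X: "X \<in> Obj ?C" and \<psi>: "\<psi> \<in> carrier (Fib P (Prd ?C [S, X]))" for X \<psi>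
  proof -
    note p = C.Prj_pair[OF S X]
    have n: "neg (Fib P (Prd ?C [S, X])) \<psi> \<in> carrier (Fib P (Prd ?C [S, X]))"
      using boolean_lattice.neg_complement(1)[OF P.fib[OF p(1)] \<psi>] .
    have "exists_q Q S X (i (Prd ?C [S, X]) \<psi>) \<in> V \<longleftrightarrow>
        forall_q Q S X (i (Prd ?C [S, X]) (neg (Fib P (Prd ?C [S, X])) \<psi>)) \<notin> V"
      using Q.exists_q_iff(2)[of S X] QD(1) S X QD(4,5)[OF p(1) \<psi>] V by simp
    then show ?thesis
      using All[OF X n] P.rdx_neg_iff[OF C.pairing(1)[OF s] \<psi> U] by auto
  qed
  then show ?thesis using that V All by blast
qed

text \<open>Counting starts at 0: \<open>pr 0\<close> projects to \<open>S\<close>,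
  \<open>pr (j + 1)\<close> to \<open>Z j\<close> and \<open>pr (h + nZ + 1)\<close> to
  \<open>W h\<close>. The test universe is shaped to hold the doctrine of subsets of
  \<open>Hom C K X\<close>, whose fibres consist of sets of arrows.\<close>

theorem theorem4p9:
  fixes P :: "('o, 'a, 'b) doctrine"
    and Q :: "('o, 'a, 'q) doctrine"
    and i :: "'o \<Rightarrow> 'b \<Rightarrow> 'q"
    and C :: "('o, 'a) fpcat"
    and S K :: 'o
    and Y W Z V :: "nat \<Rightarrow> 'o"
    and nY nW nZ nV :: nat
    and \<alpha> \<gamma> \<beta> \<delta> :: "nat \<Rightarrow> 'b"
    and pr :: "nat \<Rightarrow> 'a"
  assumes P: "boolean_doctrine P"
    and Q: "quantifier_completion TYPE(('o + 'd, 'a + 'e, 'a set + 'r) doctrine) P Q i"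
    and C: "C = Base P"
    and S: "S \<in> Obj C"
    and Y: "\<forall>u < nY. Y u \<in> Obj C"
    and W: "\<forall>h < nW. W h \<in> Obj C"
    and Z: "\<forall>j < nZ. Z j \<in> Obj C"
    and V: "\<forall>k < nV. V k \<in> Obj C"
    and \<alpha>: "\<forall>u < nY. \<alpha> u \<in> carrier (Fib P (Prd C [S, Y u]))"
    and \<gamma>: "\<forall>h < nW. \<gamma> h \<in> carrier (Fib P (Prd C [S, W h]))"
    and \<beta>: "\<forall>j < nZ. \<beta> j \<in> carrier (Fib P (Prd C [S, Z j]))"
    and \<delta>: "\<forall>k < nV. \<delta> k \<in> carrier (Fib P (Prd C [S, V k]))"
    and K: "K = Prd C (S # map Z [0..<nZ] @ map W [0..<nW])"
    and pr: "pr = Prj C (S # map Z [0..<nZ] @ map W [0..<nW])"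
  shows
    "(\<Sqinter>\<^bsub>Fib Q S\<^esub> ((\<lambda>u. forall_q Q S (Y u) (i (Prd C [S, Y u]) (\<alpha> u))) ` {..<nY}))
       \<sqinter>\<^bsub>Fib Q S\<^esub> (\<Sqinter>\<^bsub>Fib Q S\<^esub> ((\<lambda>h. exists_q Q S (W h) (i (Prd C [S, W h]) (\<gamma> h))) ` {..<nW}))
     \<sqsubseteq>\<^bsub>Fib Q S\<^esub>
     (\<Squnion>\<^bsub>Fib Q S\<^esub> ((\<lambda>j. forall_q Q S (Z j) (i (Prd C [S, Z j]) (\<beta> j))) ` {..<nZ}))
       \<squnion>\<^bsub>Fib Q S\<^esub> (\<Squnion>\<^bsub>Fib Q S\<^esub> ((\<lambda>k. exists_q Q S (V k) (i (Prd C [S, V k]) (\<delta> k))) ` {..<nV}))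
     \<longleftrightarrow>
     (\<exists>(n :: nat) (n' :: nat) (l :: nat \<Rightarrow> nat) (l' :: nat \<Rightarrow> nat) (g :: nat \<Rightarrow> 'a) (g' :: nat \<Rightarrow> 'a).
        (\<forall>u < n. l u < nY \<and> g u \<in> Hom C K (Y (l u))) \<and>
        (\<forall>k < n'. l' k < nV \<and> g' k \<in> Hom C K (V (l' k))) \<and>
        (\<Sqinter>\<^bsub>Fib P K\<^esub> ((\<lambda>u. Rdx P (pairing C (pr 0) (g u)) (\<alpha> (l u))) ` {..<n}))
          \<sqinter>\<^bsub>Fib P K\<^esub> (\<Sqinter>\<^bsub>Fib P K\<^esub> ((\<lambda>h. Rdx P (pairing C (pr 0) (pr (h + nZ + 1))) (\<gamma> h)) ` {..<nW}))
        \<sqsubseteq>\<^bsub>Fib P K\<^esub>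
        (\<Squnion>\<^bsub>Fib P K\<^esub> ((\<lambda>j. Rdx P (pairing C (pr 0) (pr (j + 1))) (\<beta> j)) ` {..<nZ}))
          \<squnion>\<^bsub>Fib P K\<^esub> (\<Squnion>\<^bsub>Fib P K\<^esub> ((\<lambda>k. Rdx P (pairing C (pr 0) (g' k)) (\<delta> (l' k))) ` {..<n'})))"
proof -
  interpret P: boolean_doctrine P by (rule P)
  interpret C: fp_category C unfolding C by (rule P.base)
  note QD = quantifier_completionD[OF Q, folded C]
  interpret Q: fo_boolean_doctrine Q by (rule QD)
  let ?Xs = "S # map Z [0..<nZ] @ map W [0..<nW]"
  have Xs: "set ?Xs \<subseteq> Obj C" using S Z W by auto
  have KO: "K \<in> Obj C" unfolding K by (rule C.Prd_Obj[OF Xs])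
  have pr_in: "pr j \<in> Hom C K (?Xs ! j)" if "j < length ?Xs" for j
    unfolding K pr by (rule C.Prj_in_Hom[OF Xs that])
  have s: "pr 0 \<in> Hom C K S" using pr_in[of 0] by simp
  have prZ: "pr (j + 1) \<in> Hom C K (Z j)" if "j < nZ" for j
    using pr_in[of "j + 1"] that by (simp add: nth_append)
  have prW: "pr (h + nZ + 1) \<in> Hom C K (W h)" if "h < nW" for h
    using pr_in[of "h + nZ + 1"] that by (simp add: nth_append)
  interpret PK: boolean_lattice "Fib P K" using P.fib KO C by simp
  interpret QS: boolean_lattice "Fib Q S" using Q.fib S QD(1) by simp
  have rdx_in: "Rdx P (pairing C (pr 0) g) \<psi> \<in> carrier (Fib P K)"
    if "g \<in> Hom C K X" "\<psi> \<in> carrier (Fib P (Prd C [S, X]))" for g X \<psi>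
    using P.rdx_closed[of "pairing C (pr 0) g" K "Prd C [S, X]"] C.pairing(1)[OF s that(1)] that(2) C
    by simp
  have i_in: "i (Prd C [S, X]) \<psi> \<in> carrier (Fib Q (Prd C [S, X]))"
    if "X \<in> Obj C" "\<psi> \<in> carrier (Fib P (Prd C [S, X]))" for X \<psi>
    using QD(4)[OF C.Prj_pair(1)[OF S that(1)] that(2)] .
  have All_in: "forall_q Q S X (i (Prd C [S, X]) \<psi>) \<in> carrier (Fib Q S)"
    and Ex_in: "exists_q Q S X (i (Prd C [S, X]) \<psi>) \<in> carrier (Fib Q S)"
    if "X \<in> Obj C" "\<psi> \<in> carrier (Fib P (Prd C [S, X]))" for X \<psi>
    using Q.forall_q(1)[of S X] Q.exists_q_iff(1)[of S X] QD(1) S that(1) i_in[OF that] by simp_all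
  let ?AllY = "\<lambda>u. forall_q Q S (Y u) (i (Prd C [S, Y u]) (\<alpha> u))"
  let ?ExW = "\<lambda>h. exists_q Q S (W h) (i (Prd C [S, W h]) (\<gamma> h))"
  let ?AllZ = "\<lambda>j. forall_q Q S (Z j) (i (Prd C [S, Z j]) (\<beta> j))"
  let ?ExV = "\<lambda>k. exists_q Q S (V k) (i (Prd C [S, V k]) (\<delta> k))"
  let ?one = "\<Sqinter>\<^bsub>Fib Q S\<^esub> (?AllY ` {..<nY}) \<sqinter>\<^bsub>Fib Q S\<^esub> \<Sqinter>\<^bsub>Fib Q S\<^esub> (?ExW ` {..<nW}) \<sqsubseteq>\<^bsub>Fib Q S\<^esub>
    \<Squnion>\<^bsub>Fib Q S\<^esub> (?AllZ ` {..<nZ}) \<squnion>\<^bsub>Fib Q S\<^esub> \<Squnion>\<^bsub>Fib Q S\<^esub> (?ExV ` {..<nV})"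
  have one: "?one \<longleftrightarrow>
      (\<forall>U. ultrafilter (Fib Q S) U \<longrightarrow> (\<forall>u < nY. ?AllY u \<in> U) \<longrightarrow> (\<forall>h < nW. ?ExW h \<in> U) \<longrightarrow>
        (\<exists>j < nZ. ?AllZ j \<in> U) \<or> (\<exists>k < nV. ?ExV k \<in> U))"
    by (rule QS.sequent_iff_ultrafilter) (use All_in Ex_in Y W Z V \<alpha> \<beta> \<gamma> \<delta> in auto)
  let ?r = "\<lambda>g \<psi>. Rdx P (pairing C (pr 0) g) \<psi>"
  let ?\<gamma>' = "\<lambda>h. ?r (pr (h + nZ + 1)) (\<gamma> h)" and ?\<beta>' = "\<lambda>j. ?r (pr (j + 1)) (\<beta> j)"
  have \<alpha>_in: "?r g (\<alpha> u) \<in> carrier (Fib P K)" if "u < nY" "g \<in> Hom C K (Y u)" for u g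
    using rdx_in[OF that(2)] \<alpha> that(1) by simp
  have \<delta>_in: "?r g (\<delta> k) \<in> carrier (Fib P K)" if "k < nV" "g \<in> Hom C K (V k)" for k g
    using rdx_in[OF that(2)] \<delta> that(1) by simp
  have \<gamma>_in: "?\<gamma>' h \<in> carrier (Fib P K)" if "h < nW" for h
    using rdx_in[OF prW[OF that]] \<gamma> that by simp
  have \<beta>_in: "?\<beta>' j \<in> carrier (Fib P K)" if "j < nZ" for j
    using rdx_in[OF prZ[OF that]] \<beta> that by simp
  let ?seq = "\<lambda>n n' l l' g g'. \<Sqinter>\<^bsub>Fib P K\<^esub> ((\<lambda>u. ?r (g u) (\<alpha> (l u))) ` {..<n}) \<sqinter>\<^bsub>Fib P K\<^esub>
      \<Sqinter>\<^bsub>Fib P K\<^esub> (?\<gamma>' ` {..<nW}) \<sqsubseteq>\<^bsub>Fib P K\<^esub>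
      \<Squnion>\<^bsub>Fib P K\<^esub> (?\<beta>' ` {..<nZ}) \<squnion>\<^bsub>Fib P K\<^esub>
      \<Squnion>\<^bsub>Fib P K\<^esub> ((\<lambda>k. ?r (g' k) (\<delta> (l' k))) ` {..<n'})"
  let ?two = "\<exists>(n :: nat) (n' :: nat) l l' g g'. (\<forall>u < n. l u < nY \<and> g u \<in> Hom C K (Y (l u))) \<and>
      (\<forall>k < n'. l' k < nV \<and> g' k \<in> Hom C K (V (l' k))) \<and> ?seq n n' l l' g g'"
  have two: "?seq n n' l l' g g' \<longleftrightarrow>
      (\<forall>U. ultrafilter (Fib P K) U \<longrightarrow> (\<forall>u < n. ?r (g u) (\<alpha> (l u)) \<in> U) \<longrightarrow>
        (\<forall>h < nW. ?\<gamma>' h \<in> U) \<longrightarrow> (\<exists>j < nZ. ?\<beta>' j \<in> U) \<or> (\<exists>k < n'. ?r (g' k) (\<delta> (l' k)) \<in> U))"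
    if "\<forall>u < n. l u < nY \<and> g u \<in> Hom C K (Y (l u))" "\<forall>k < n'. l' k < nV \<and> g' k \<in> Hom C K (V (l' k))"
    for n n' :: nat and l l' g g'
    by (rule PK.sequent_iff_ultrafilter) (use that \<alpha>_in \<beta>_in \<gamma>_in \<delta>_in in simp_all)
  show ?thesis
  proof
    assume L: ?one
    show ?two
    proof (rule ccontr)
      assume no: "\<not> ?two"
      \<comment> \<open>The index sets of all instances at stage \<open>K\<close>. \<open>?A\<close>
        must become true and \<open>?B\<close> false; \<gamma> and \<beta> enter only at the
        projections, which are their generic elements.\<close>
      let ?IA = "SIGMA u:{..<nY}. Hom C K (Y u)" and ?IB = "SIGMA k:{..<nV}. Hom C K (V k)"
      let ?fA = "\<lambda>(u, g). ?r g (\<alpha> u)" and ?fB = "\<lambda>(k, g). ?r g (\<delta> k)"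
      let ?A = "?fA ` ?IA \<union> ?\<gamma>' ` {..<nW}" and ?B = "?fB ` ?IB \<union> ?\<beta>' ` {..<nZ}"
      have "\<exists>U. ultrafilter (Fib P K) U \<and> ?A \<subseteq> U \<and> ?B \<inter> U = {}"
      proof (rule PK.ultrafilter_separation)
        show Ac: "?A \<subseteq> carrier (Fib P K)" using \<alpha>_in \<gamma>_in by auto
        show Bc: "?B \<subseteq> carrier (Fib P K)" using \<delta>_in \<beta>_in by auto
        show "\<not> \<Sqinter>\<^bsub>Fib P K\<^esub> E \<sqsubseteq>\<^bsub>Fib P K\<^esub> \<Squnion>\<^bsub>Fib P K\<^esub> F"
          if E: "finite E" "E \<subseteq> ?A" and F: "finite F" "F \<subseteq> ?B" for E F
        proof
          assume le: "\<Sqinter>\<^bsub>Fib P K\<^esub> E \<sqsubseteq>\<^bsub>Fib P K\<^esub> \<Squnion>\<^bsub>Fib P K\<^esub> F"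
          have Ec: "E \<subseteq> carrier (Fib P K)" and Fc: "F \<subseteq> carrier (Fib P K)"
            using E(2) F(2) Ac Bc by (meson order_trans)+
          have "finite (E \<inter> ?fA ` ?IA)" "E \<inter> ?fA ` ?IA \<subseteq> ?fA ` ?IA" using E(1) by simp_all
          from finite_subset_image[OF this] obtain I
            where I: "I \<subseteq> ?IA" "finite I" "E \<inter> ?fA ` ?IA = ?fA ` I" by blast
          have "finite (F \<inter> ?fB ` ?IB)" "F \<inter> ?fB ` ?IB \<subseteq> ?fB ` ?IB" using F(1) by simp_all
          from finite_subset_image[OF this] obtain J
            where J: "J \<subseteq> ?IB" "finite J" "F \<inter> ?fB ` ?IB = ?fB ` J" by blast
          \<comment> \<open>Listing the finitely many instances used supplies the data of (2): the
            lengths are \<open>n\<close> and \<open>n'\<close>, first components give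
            \<open>l\<close> and \<open>l'\<close>, second components \<open>g\<close> and
            \<open>g'\<close>.\<close>
          obtain xs where xs: "set xs = I" using finite_list[OF I(2)] by blast
          obtain ys where ys: "set ys = J" using finite_list[OF J(2)] by blast
          let ?l = "\<lambda>u. fst (xs ! u)" and ?g = "\<lambda>u. snd (xs ! u)"
          let ?l' = "\<lambda>k. fst (ys ! k)" and ?g' = "\<lambda>k. snd (ys ! k)"
          have x: "\<forall>u < length xs. ?l u < nY \<and> ?g u \<in> Hom C K (Y (?l u))"
          proof (intro allI impI)
            fix u assume "u < length xs"
            then have "xs ! u \<in> ?IA" using I(1) xs nth_mem by blast
            then show "?l u < nY \<and> ?g u \<in> Hom C K (Y (?l u))" by (auto simp: mem_Sigma_iff split_beta)
          qed
          have y: "\<forall>k < length ys. ?l' k < nV \<and> ?g' k \<in> Hom C K (V (?l' k))"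
          proof (intro allI impI)
            fix k assume "k < length ys"
            then have "ys ! k \<in> ?IB" using J(1) ys nth_mem by blast
            then show "?l' k < nV \<and> ?g' k \<in> Hom C K (V (?l' k))" by (auto simp: mem_Sigma_iff split_beta)
          qed
          have "(\<exists>j < nZ. ?\<beta>' j \<in> U) \<or> (\<exists>k < length ys. ?r (?g' k) (\<delta> (?l' k)) \<in> U)"
            if U: "ultrafilter (Fib P K) U" and \<alpha>U: "\<forall>u < length xs. ?r (?g u) (\<alpha> (?l u)) \<in> U"
              and \<gamma>U: "\<forall>h < nW. ?\<gamma>' h \<in> U" for U
          proof -
            have "E \<subseteq> U"
            proof
              fix e assume e: "e \<in> E"
              show "e \<in> U"
              proof (cases "e \<in> ?fA ` ?IA")
                case True
                then have "e \<in> ?fA ` I" using I(3) e by blast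
                then obtain t where t: "t \<in> I" "e = ?fA t" by blast
                then obtain u where "u < length xs" "t = xs ! u" using xs by (metis in_set_conv_nth)
                then show ?thesis using \<alpha>U t(2) by (simp add: split_beta)
              next
                case False
                then show ?thesis using e E(2) \<gamma>U by blast
              qed
            qed
            then have "\<Sqinter>\<^bsub>Fib P K\<^esub> E \<in> U" using PK.ultrafilter_inf_iff[OF U E(1) Ec] by simp
            then have "\<Squnion>\<^bsub>Fib P K\<^esub> F \<in> U"
              using PK.ultrafilter_mono[OF U _ le PK.finite_sup_facts(1)[OF F(1) Fc]] by simp
            then obtain e where e: "e \<in> F" "e \<in> U" using PK.ultrafilter_sup_iff[OF U F(1) Fc] by blast
            show ?thesis
            proof (cases "e \<in> ?fB ` ?IB")
              case True
              then have "e \<in> ?fB ` J" using J(3) e by blast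
              then obtain t where t: "t \<in> J" "e = ?fB t" by blast
              then obtain k where "k < length ys" "t = ys ! k" using ys by (metis in_set_conv_nth)
              then show ?thesis using e(2) t(2) by (auto simp: split_beta)
            next
              case False
              then show ?thesis using e F(2) by blast
            qed
          qed
          then have "?seq (length xs) (length ys) ?l ?l' ?g ?g'" unfolding two[OF x y] by blast
          with x y have ?two
            by (intro exI[of _ "length xs"] exI[of _ "length ys"] exI[of _ ?l] exI[of _ ?l']
                exI[of _ ?g] exI[of _ ?g'] conjI)
          then show False by (rule notE[OF no])
        qed
      qed
      then obtain U where U: "ultrafilter (Fib P K) U" and AU: "?A \<subseteq> U" and BU: "?B \<inter> U = {}" by blast
      have s': "pr 0 \<in> Hom (Base P) K S" using s C by simp
      obtain U' where U': "ultrafilter (Fib Q S) U'"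
        and All: "\<And>X \<psi>. \<lbrakk>X \<in> Obj C; \<psi> \<in> carrier (Fib P (Prd C [S, X]))\<rbrakk> \<Longrightarrow>
          forall_q Q S X (i (Prd C [S, X]) \<psi>) \<in> U' \<longleftrightarrow> (\<forall>g \<in> Hom C K X. ?r g \<psi> \<in> U)"
        and Ex: "\<And>X \<psi>. \<lbrakk>X \<in> Obj C; \<psi> \<in> carrier (Fib P (Prd C [S, X]))\<rbrakk> \<Longrightarrow>
          exists_q Q S X (i (Prd C [S, X]) \<psi>) \<in> U' \<longleftrightarrow> (\<exists>g \<in> Hom C K X. ?r g \<psi> \<in> U)"
        using completion_stage_model[OF P Q U s', folded C] by blast
      \<comment> \<open>\<open>U'\<close> contradicts (1). The \<forall>\<alpha> hold since all
        their instances are in \<open>U\<close>, and the \<exists>\<gamma> are witnessed by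
        projections; then each \<forall>\<beta> fails at its projection, and each \<exists>\<delta>
        has no instance in \<open>U\<close>.\<close>
      have "?AllY u \<in> U'" if "u < nY" for u
        using All[of "Y u" "\<alpha> u"] that Y \<alpha> AU by fastforce
      moreover have "?ExW h \<in> U'" if "h < nW" for h
        using Ex[of "W h" "\<gamma> h"] that W \<gamma> AU prW[OF that] by blast
      ultimately consider j where "j < nZ" "?AllZ j \<in> U'" | k where "k < nV" "?ExV k \<in> U'"
        using one L U' by blast
      then show False
      proof cases
        case 1
        then have "?\<beta>' j \<in> U" using All[of "Z j" "\<beta> j"] Z \<beta> prZ by blast
        then show False using BU 1 by blast
      next
        case 2
        then obtain g where "g \<in> Hom C K (V k)" "?r g (\<delta> k) \<in> U" using Ex[of "V k" "\<delta> k"] V \<delta> by blast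
        then show False using BU 2 by fastforce
      qed
    qed
  next
    assume ?two
    then obtain n n' :: nat and l l' g g'
      where l: "\<forall>u < n. l u < nY \<and> g u \<in> Hom C K (Y (l u))"
        and l': "\<forall>k < n'. l' k < nV \<and> g' k \<in> Hom C K (V (l' k))"
        and seq: "?seq n n' l l' g g'"
      by (elim exE conjE) (rule that)
    show ?one unfolding one
    proof (intro allI impI, rule ccontr)
      fix U
      assume U: "ultrafilter (Fib Q S) U" and UY: "\<forall>u < nY. ?AllY u \<in> U" and UW: "\<forall>h < nW. ?ExW h \<in> U"
        and no: "\<not> ((\<exists>j < nZ. ?AllZ j \<in> U) \<or> (\<exists>k < nV. ?ExV k \<in> U))"
      let ?negW = "\<lambda>h. neg (Fib Q (Prd C [S, W h])) (i (Prd C [S, W h]) (\<gamma> h))"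
      let ?negV = "\<lambda>k. neg (Fib Q (Prd C [S, V k])) (i (Prd C [S, V k]) (\<delta> k))"
      have neg_in: "neg (Fib Q (Prd C [S, X])) (i (Prd C [S, X]) \<psi>) \<in> carrier (Fib Q (Prd C [S, X]))"
        if "X \<in> Obj C" "\<psi> \<in> carrier (Fib P (Prd C [S, X]))" for X \<psi>
        using boolean_lattice.neg_complement(1)[OF Q.fib i_in[OF that]] C.Prj_pair(1)[OF S that(1)] QD(1) by simp
      \<comment> \<open>The formulas whose variables are discharged: \<beta> over \<open>Z\<close>
        and \<not>\<gamma> over \<open>W\<close>, the latter because \<exists>\<gamma> fails exactly
        when \<forall>\<not>\<gamma> holds. The order is that of the factors of
        \<open>K\<close>.\<close>
      let ?Ts = "map (\<lambda>j. (Z j, i (Prd C [S, Z j]) (\<beta> j))) [0..<nZ] @ map (\<lambda>h. (W h, ?negW h)) [0..<nW]"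
      have Ts: "S # map fst ?Ts = ?Xs" by (simp add: comp_def)
      have Ts_nth: "?Ts ! j = (if j < nZ then (Z j, i (Prd C [S, Z j]) (\<beta> j)) else (W (j - nZ), ?negW (j - nZ)))"
        if "j < nZ + nW" for j
        using that by (cases "j < nZ") (auto simp: nth_append)
      let ?F = "?AllY ` {..<nY}" and ?G = "?ExV ` {..<nV}"
      have F: "finite ?F" "?F \<subseteq> carrier (Fib Q S)" using All_in Y \<alpha> by auto
      have G: "finite ?G" "?G \<subseteq> carrier (Fib Q S)" using Ex_in V \<delta> by auto
      note c = QS.finite_inf_facts(1)[OF F] QS.finite_sup_facts(1)[OF G]
      \<comment> \<open>The side formula collects what is instantiated by terms: all
        \<forall>\<alpha>, and the failure of all \<exists>\<delta>. It lives over \<open>S\<close>,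
        so it stays fixed while variables are discharged.\<close>
      define \<phi> where "\<phi> = \<Sqinter>\<^bsub>Fib Q S\<^esub> ?F \<sqinter>\<^bsub>Fib Q S\<^esub> neg (Fib Q S) (\<Squnion>\<^bsub>Fib Q S\<^esub> ?G)"
      have \<phi>: "\<phi> \<in> carrier (Fib Q S)" unfolding \<phi>_def using c QS.neg_complement(1)[OF c(2)] by simp
      have \<phi>_iff: "\<phi> \<in> T \<longleftrightarrow> (\<forall>u < nY. ?AllY u \<in> T) \<and> (\<forall>k < nV. ?ExV k \<notin> T)"
        if T: "ultrafilter (Fib Q S) T" for T
        unfolding \<phi>_def QS.ultrafilter_meet_neg_iff[OF T c] QS.ultrafilter_inf_iff[OF T F]
          QS.ultrafilter_sup_iff[OF T G] by (simp add: image_subset_iff Ball_def Bex_def)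
      have "\<exists>j < length ?Ts. forall_q Q S (fst (?Ts ! j)) (snd (?Ts ! j)) \<in> U"
      proof (rule Q.forall_q_disjunction[OF _ _ \<phi> _ U], unfold QD(1) Ts)
        show "S \<in> Obj C" by (rule S)
        show "\<phi> \<in> U" using \<phi>_iff[OF U] UY no by blast
        show "X \<in> Obj C \<and> \<theta> \<in> carrier (Fib Q (Prd C [S, X]))" if "(X, \<theta>) \<in> set ?Ts" for X \<theta>
          using that i_in neg_in Z W \<beta> \<gamma> by auto
        fix T assume T: "ultrafilter (Fib Q (Prd C ?Xs)) T" "Rdx Q (Prj C ?Xs 0) \<phi> \<in> T"
        then have T: "ultrafilter (Fib Q K) T" and T\<phi>: "Rdx Q (pr 0) \<phi> \<in> T" unfolding K pr by auto
        have s': "pr 0 \<in> Hom (Base Q) K S" using s QD(1) by simp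
        have inst: "Rdx Q (pairing C (pr 0) f) \<psi> \<in> T"
          if "f \<in> Hom C K X" "\<psi> \<in> carrier (Fib Q (Prd C [S, X]))" "Rdx Q (pr 0) (forall_q Q S X \<psi>) \<in> T"
          for f X \<psi>
          using Q.forall_q_instance[OF s' _ _ T that(3)] that(1,2) QD(1) by simp
        have neg_iff: "Rdx Q (pairing C (pr 0) f) (neg (Fib Q (Prd C [S, X])) \<psi>) \<in> T \<longleftrightarrow>
            Rdx Q (pairing C (pr 0) f) \<psi> \<notin> T"
          if "f \<in> Hom C K X" "\<psi> \<in> carrier (Fib Q (Prd C [S, X]))" for f X \<psi>
          using Q.rdx_neg_iff[of "pairing C (pr 0) f" K "Prd C [S, X]" \<psi> T] C.pairing(1)[OF s that(1)]
            that(2) T QD(1) by simp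
        let ?T0 = "{x \<in> carrier (Fib Q S). Rdx Q (pr 0) x \<in> T}"
        note T0 = Q.rdx_ultrafilter[OF s' T]
        have "\<phi> \<in> ?T0" using T\<phi> \<phi> by simp
        then have TY: "\<forall>u < nY. ?AllY u \<in> ?T0" and TV: "\<forall>k < nV. ?ExV k \<notin> ?T0"
          using \<phi>_iff[OF T0] by blast+
        \<comment> \<open>The inequality (2) holds in \<open>P\<close>, while \<open>T\<close> is an
          ultrafilter of the completion over \<open>K\<close>; pulling \<open>T\<close> back along
          \<open>i\<close> makes (2) applicable.\<close>
        let ?T1 = "{x \<in> carrier (Fib P K). i K x \<in> T}"
        have T1: "ultrafilter (Fib P K) ?T1"
          by (rule boolean_hom_ultrafilter[OF QD(3)[OF KO] PK.boolean_lattice_axioms T])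
        have T1_iff: "?r f \<psi> \<in> ?T1 \<longleftrightarrow> Rdx Q (pairing C (pr 0) f) (i (Prd C [S, X]) \<psi>) \<in> T"
          if "f \<in> Hom C K X" "\<psi> \<in> carrier (Fib P (Prd C [S, X]))" for f X \<psi>
          using QD(6)[OF C.pairing(1)[OF s that(1)] that(2)] rdx_in[OF that] by simp
        show "\<exists>j < length ?Ts. Rdx Q (pairing C (Prj C ?Xs 0) (Prj C ?Xs (Suc j))) (snd (?Ts ! j)) \<in> T"
        proof (rule ccontr, fold pr)
          assume none: "\<not> (\<exists>j < length ?Ts. Rdx Q (pairing C (pr 0) (pr (Suc j))) (snd (?Ts ! j)) \<in> T)"
          have noZ: "?\<beta>' j \<notin> ?T1" if j: "j < nZ" for j
          proof -
            have "Rdx Q (pairing C (pr 0) (pr (Suc j))) (snd (?Ts ! j)) \<notin> T" using none j by simp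
            then show ?thesis using T1_iff[OF prZ[OF j]] \<beta> j Ts_nth[of j] by simp
          qed
          \<comment> \<open>Entry \<open>h + nZ\<close> of \<open>?Ts\<close> is the negated
            \<gamma>, and its variable is projection \<open>h + nZ + 1\<close>, shifted by one
            because \<open>S\<close> comes first. Failure of this entry is truth of
            \<gamma>.\<close>
          have allW: "?\<gamma>' h \<in> ?T1" if h: "h < nW" for h
          proof -
            have "Rdx Q (pairing C (pr 0) (pr (Suc (h + nZ)))) (snd (?Ts ! (h + nZ))) \<notin> T"
              using none h by simp
            then have "Rdx Q (pairing C (pr 0) (pr (h + nZ + 1))) (?negW h) \<notin> T"
              using Ts_nth[of "h + nZ"] h by simp
            then show ?thesis
              using T1_iff[OF prW[OF h]] neg_iff[OF prW[OF h] i_in] W \<gamma> h by simp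
          qed
          have allY: "?r (g u) (\<alpha> (l u)) \<in> ?T1" if u: "u < n" for u
          proof -
            have lu: "l u < nY" "g u \<in> Hom C K (Y (l u))" using l u by auto
            then have "Rdx Q (pr 0) (?AllY (l u)) \<in> T" using TY by blast
            then show ?thesis using inst[OF lu(2) i_in] T1_iff[OF lu(2)] Y \<alpha> lu(1) by simp
          qed
          have "?r (g' k) (\<delta> (l' k)) \<notin> ?T1" if k: "k < n'" for k
          proof -
            have lk: "l' k < nV" "g' k \<in> Hom C K (V (l' k))" using l' k by auto
            have Vk: "V (l' k) \<in> Obj C" and \<delta>k: "\<delta> (l' k) \<in> carrier (Fib P (Prd C [S, V (l' k)]))"
              using V \<delta> lk by auto
            \<comment> \<open>Failure of \<exists>\<delta> is truth of \<forall>\<not>\<delta>,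
              which can be instantiated at \<open>g' k\<close> just like the
              \<forall>\<alpha>.\<close>
            have "forall_q Q S (V (l' k)) (?negV (l' k)) \<in> ?T0"
              using Q.exists_q_iff(2)[of S "V (l' k)", OF _ _ _ T0] S Vk i_in[OF Vk \<delta>k] TV lk(1) QD(1) by auto
            then have "Rdx Q (pairing C (pr 0) (g' k)) (?negV (l' k)) \<in> T"
              using inst[OF lk(2) neg_in[OF Vk \<delta>k]] by simp
            then show ?thesis using neg_iff[OF lk(2) i_in[OF Vk \<delta>k]] T1_iff[OF lk(2) \<delta>k] by simp
          qed
          then show False using seq two[OF l l'] T1 allY allW noZ by blast
        qed
      qed
      \<comment> \<open>The entry found is either some \<forall>\<beta>, which was assumed to be
        outside \<open>U\<close>, or some \<forall>\<not>\<gamma>, which contradicts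
        \<exists>\<gamma> in \<open>U\<close>.\<close>
      then obtain j where j: "j < nZ + nW" "forall_q Q S (fst (?Ts ! j)) (snd (?Ts ! j)) \<in> U" by auto
      show False
      proof (cases "j < nZ")
        case True
        then show False using j no Ts_nth[of j] by auto
      next
        case False
        then have h: "j - nZ < nW" using j by simp
        have "forall_q Q S (W (j - nZ)) (?negW (j - nZ)) \<in> U" using j False Ts_nth[of j] by simp
        then show False
          using Q.exists_q_iff(2)[of S "W (j - nZ)", OF _ _ _ U] S W i_in[of "W (j - nZ)"] \<gamma> h UW QD(1) by auto
      qed
    qed
  qed
qed

end
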